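(* Let $d\ge 3$. There exists a constant $C>0$ depending only on $d$ such that for every $R>0$, $$\Psi(R)< C R^{-(d-1)},$$ where $\Psi(R)=1-\bar\mu_0(E_R)$ and $E_R=\{L\in\Omega_0 : Q_0(L)\le R\}$.
   Context: Let $\Omega_0=\mathrm{SL}_{d-1}(\mathbb R)/\mathrm{SL}_{d-1}(\mathbb Z)$, identified with the space of unimodular (covolume $1$) lattices in $\mathbb R^{d-1}$ via $g\,\mathrm{SL}_{d-1}(\mathbb Z)\leftrightarrow g\mathbb Z^{d-1}$, and let $\bar\mu_0$ be the left $\mathrm{SL}_{d-1}(\mathbb R)$-invariant probability measure on $\Omega_0$. For a lattice $L\subset\mathbb R^{d-1}$ the covering radius is $Q_0(L)=\inf\{t\in\mathbb R^+ : t\Delta_{d-1}+L=\mathbb R^{d-1}\}$, where $\Delta_{d-1}=\{\boldsymbol x\in\mathbb R^{d-1} : x_i\ge 0,\ \sum_{i=1}^{d-1}x_i\le 1\}$ is the standard simplex. *)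

theory Defs
  imports "HOL-Probability.Probability"
begin

definition SL_real :: "(real^'n^'n) set" where
  "SL_real = {g. det g = 1}"

definition SL_int :: "(real^'n^'n) set" where
  "SL_int = {g \<in> SL_real. \<forall>i j. g $ i $ j \<in> \<int>}"

definition int_vectors :: "(real^'n) set" where
  "int_vectors = {v. \<forall>i. v $ i \<in> \<int>}"

definition lattice_of :: "real^'n^'n \<Rightarrow> (real^'n) set" where
  "lattice_of g = (\<lambda>v. g *v v) ` int_vectors"

text \<open>
  The homogeneous space of SL(n, R) modulo SL(n, Z), as the set of lattices \<open>g \<int>\<^sup>n\<close>.
  The lemma \<open>lattice_of_eq_iff\<close> below shows that the fibres of \<^const>\<open>lattice_of\<close>
  over it are exactly the cosets \<open>g SL(n, Z)\<close>.
\<close>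
definition Omega0 :: "(real^'n) set set" where
  "Omega0 = lattice_of ` SL_real"

definition Omega0_open :: "(real^'n) set set \<Rightarrow> bool" where
  "Omega0_open U \<longleftrightarrow> U \<subseteq> Omega0 \<and>
     openin (top_of_set SL_real) {g \<in> SL_real. lattice_of g \<in> U}"

text \<open>The quotient topology; see \<open>quotient_map_lattice_of\<close> below.\<close>
definition Omega0_topology :: "(real^'n) set topology" where
  "Omega0_topology = topology Omega0_open"

definition Omega0_borel :: "(real^'n) set measure" where
  "Omega0_borel = sigma Omega0 {U. openin Omega0_topology U}"

text \<open>
  There is exactly one such measure, the normalised Haar measure. Its existence and uniqueness
  are not proved here; statements about it quantify over all \<open>\<mu>\<close> with this property.
\<close>
definition invariant_prob_measure :: "(real^'n) set measure \<Rightarrow> bool" where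
  "invariant_prob_measure \<mu> \<longleftrightarrow>
     prob_space \<mu> \<and> sets \<mu> = sets Omega0_borel \<and>
     (\<forall>g\<in>SL_real. \<forall>A\<in>sets \<mu>. emeasure \<mu> ((\<lambda>L. (\<lambda>v. g *v v) ` L) ` A) = emeasure \<mu> A)"

definition std_simplex :: "(real^'n) set" where
  "std_simplex = {x. (\<forall>i. 0 \<le> x $ i) \<and> (\<Sum>i\<in>UNIV. x $ i) \<le> 1}"

definition covering_radius :: "(real^'n) set \<Rightarrow> real" where
  "covering_radius L = Inf {t. t > 0 \<and> {t *\<^sub>R x + l | x l. x \<in> std_simplex \<and> l \<in> L} = UNIV}"

definition covering_sublevel :: "real \<Rightarrow> (real^'n) set set" where
  "covering_sublevel R = {L \<in> Omega0. covering_radius L \<le> R}"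

definition Psi :: "(real^'n) set measure \<Rightarrow> real \<Rightarrow> real" where
  "Psi \<mu> R = 1 - measure \<mu> (covering_sublevel R)"

lemma istopology_Omega0_open: "istopology (Omega0_open :: (real^'n) set set \<Rightarrow> bool)"
  unfolding istopology_def
proof (intro conjI allI impI)
  fix S T :: "(real^'n) set set" assume S: "Omega0_open S" and T: "Omega0_open T"
  have "{g \<in> SL_real. lattice_of g \<in> S \<inter> T} =
      {g \<in> SL_real. lattice_of g \<in> S} \<inter> {g \<in> SL_real. lattice_of g \<in> T}" by auto
  with S T show "Omega0_open (S \<inter> T)"
    by (auto simp: Omega0_open_def intro!: openin_Int)
next
  fix \<K> :: "(real^'n) set set set" assume K: "\<forall>K\<in>\<K>. Omega0_open K"
  have "{g \<in> SL_real. lattice_of g \<in> \<Union>\<K>} =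
      (\<Union>K\<in>\<K>. {g \<in> SL_real. lattice_of g \<in> K})" by auto
  with K show "Omega0_open (\<Union>\<K>)"
    by (auto simp: Omega0_open_def intro!: openin_Union)
qed

lemma openin_Omega0: "openin Omega0_topology = Omega0_open"
  by (simp add: Omega0_topology_def topology_inverse' istopology_Omega0_open)

lemma topspace_Omega0: "topspace Omega0_topology = (Omega0 :: (real^'n) set set)"
proof -
  have "{g \<in> SL_real. lattice_of g \<in> Omega0} = (SL_real :: (real^'n^'n) set)"
    by (auto simp: Omega0_def)
  then have "Omega0_open (Omega0 :: (real^'n) set set)"
    by (simp add: Omega0_open_def)
  then show ?thesis
    unfolding topspace_def openin_Omega0 by (auto simp: Omega0_open_def)
qed

lemma quotient_map_lattice_of:
  "quotient_map (top_of_set SL_real) Omega0_topology lattice_of"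
  by (auto simp: quotient_map_def topspace_Omega0 openin_Omega0 Omega0_open_def Omega0_def)

lemma lattice_of_eq_iff:
  fixes g h :: "real^'n^'n"
  assumes "g \<in> SL_real" "h \<in> SL_real"
  shows "lattice_of g = lattice_of h \<longleftrightarrow> (\<exists>\<gamma>\<in>SL_int. h = g ** \<gamma>)"
proof -
  have *: "\<exists>\<gamma>\<in>SL_int. b = a ** \<gamma>"
    if "a \<in> SL_real" "b \<in> SL_real" "lattice_of b \<subseteq> lattice_of a" for a b :: "real^'n^'n"
  proof -
    have "invertible a" using that by (simp add: SL_real_def invertible_det_nz)
    then obtain a' where a': "a ** a' = mat 1" "a' ** a = mat 1"
      unfolding invertible_def by blast
    let ?c = "a' ** b"
    have b: "b = a ** ?c" by (simp add: matrix_mul_assoc a')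
    have "det a * det ?c = det b" by (metis b det_mul)
    then have "det ?c = 1" using that by (simp add: SL_real_def)
    moreover have "?c $ i $ j \<in> \<int>" for i j
    proof -
      have "axis j 1 \<in> (int_vectors :: (real^'n) set)"
        by (auto simp: int_vectors_def axis_def)
      then have "b *v axis j 1 \<in> lattice_of a"
        using that(3) by (auto simp: lattice_of_def)
      then obtain v where v: "v \<in> int_vectors" "b *v axis j 1 = a *v v"
        by (auto simp: lattice_of_def)
      have "?c *v axis j 1 = a' *v (a *v v)"
        by (metis v(2) matrix_vector_mul_assoc)
      also have "\<dots> = v" by (simp add: matrix_vector_mul_assoc a')
      finally have "column j ?c = v" by (simp add: matrix_vector_mult_basis)
      then have "?c $ i $ j = v $ i" by (metis column_def vec_lambda_beta)
      then show ?thesis using v(1) by (simp add: int_vectors_def)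
    qed
    ultimately have "?c \<in> SL_int" by (simp add: SL_int_def SL_real_def)
    with b show ?thesis by blast
  qed
  have sub: "lattice_of (a ** c) \<subseteq> lattice_of a" if "c \<in> SL_int" for a c :: "real^'n^'n"
  proof -
    have "c *v v \<in> int_vectors" if "v \<in> int_vectors" for v
      using that \<open>c \<in> SL_int\<close>
      by (auto simp: int_vectors_def SL_int_def matrix_vector_mult_def intro!: Ints_sum Ints_mult)
    then show ?thesis
      by (auto simp: lattice_of_def matrix_vector_mul_assoc [symmetric])
  qed
  show ?thesis
  proof
    assume "lattice_of g = lattice_of h"
    with * [OF assms] show "\<exists>\<gamma>\<in>SL_int. h = g ** \<gamma>" by simp
  next
    assume "\<exists>\<gamma>\<in>SL_int. h = g ** \<gamma>"
    then obtain c where c: "c \<in> SL_int" "h = g ** c" by blast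
    have int_det: "det m \<in> \<int>" if "\<forall>i j. m $ i $ j \<in> \<int>" for m :: "real^'n^'n"
      using that by (auto simp: det_def intro!: Ints_sum Ints_mult Ints_prod)
    have dc: "det c = 1" using c by (simp add: SL_int_def SL_real_def)
    then have "invertible c" by (simp add: invertible_det_nz)
    then obtain c' where c': "c ** c' = mat 1" "c' ** c = mat 1"
      unfolding invertible_def by blast
    have "det c * det c' = 1" by (metis c'(1) det_mul det_I)
    then have dc': "det c' = 1" using dc by simp
    have "c' $ k $ j \<in> \<int>" for k j
    proof -
      have "c *v column j c' = axis j 1"
        by (metis c'(1) matrix_vector_mul_assoc matrix_vector_mul_lid matrix_vector_mult_basis)
      then have "column j c' =
          (\<chi> k. det (\<chi> i l. if l = k then axis j 1 $ i else c $ i $ l) / det c)"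
        using cramer [of c] dc by simp
      then have "c' $ k $ j = det (\<chi> i l. if l = k then axis j 1 $ i else c $ i $ l)"
        using dc by (metis (no_types, lifting) column_def div_by_1 vec_lambda_beta)
      also have "\<dots> \<in> \<int>"
        using c(1) by (intro int_det) (auto simp: SL_int_def axis_def)
      finally show ?thesis .
    qed
    then have "c' \<in> SL_int" using dc' by (simp add: SL_int_def SL_real_def)
    then have "lattice_of (h ** c') \<subseteq> lattice_of h" by (rule sub)
    moreover have "h ** c' = g" by (simp add: c(2) c' matrix_mul_assoc [symmetric])
    ultimately show "lattice_of g = lattice_of h" using sub [OF c(1), of g] c(2) by auto
  qed
qed

end

(*
  Siegel's estimate by averaging over finitely many group elements.  The covering radius of L is
  at most a constant divided by the length of a shortest vector of the dual lattice, so if it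
  exceeds R, then the dual lattice has a nonzero vector of length O(1/R), and hence, after passing
  to an integer multiple, a vector in one of the n regions
      slab k e = {w. e / 3 < w_k, |w_i| < e for all i},   e = O(1/R).

  For each k there are N matrices of determinant 1 that move the slab to pairwise disjoint sets,
  all contained in one box of side 2 T, with N comparable to (T/e)^n.  By invariance all N images
  are hit by the dual lattice with the same probability.  A unimodular lattice has O(T^n) points
  in the box once T is large in terms of the lattice, so that it hits at most O(T^n) of the images,
  and the common probability is O(T^n / N) = O(e^n) = O(R^-n).
*)
theory Submission
  imports Defs
begin

section \<open>A transference inequality\<close>

text \<open>Invariance is all that is known about the measure, so no mean value formula is
  available. The obstacle is uniformity: the count O(T^n) holds only for T beyond a bound that
  depends on the lattice, and the space of lattices is not compact. It is therefore made on
  \<open>bounded_lattices K\<close> only. The slab estimate then carries the error 1 -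
  mu(\<open>bounded_lattices K\<close>), while its main term depends neither on K nor on the number
  of matrices, so that K can tend to infinity with e fixed. The lower bound on w_k makes disjoint
  images possible, since a shear hardly moves points with w_k near 0. The matrices are shears with n
  - 1 parameters below m, rescaled by s; this gives N = m^(n-1) and T = 6 m e / s, and with s^n = 6
  m the quotient T^n / N is exactly 6^(n-1) e^n. Then T = e s^(n-1), which grows with s because n =
  d - 1 is at least 2.\<close>

lemma nearest_integer:
  fixes a :: real
  obtains k :: int where "\<bar>a - k\<bar> \<le> 1 / 2"
  using of_int_round_abs_le[of a] by (metis abs_minus_commute)

text \<open>An attained minimum would require a discreteness argument. The infimum of the squared
  norms is at least \<open>lam\<^sup>2 > 0\<close>, hence strictly below its double. The factor 2 is
  affordable: reduction modulo \<open>w\<close> leaves a coefficient of square at most 1/4, and 2 *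
  1/4 < 1.\<close>

lemma nearly_shortest_vector:
  fixes M :: "'a::real_normed_vector set"
  assumes "M \<noteq> {}" and "lam > 0" and "\<And>m. m \<in> M \<Longrightarrow> lam \<le> norm m"
  obtains w where "w \<in> M" and "\<And>m. m \<in> M \<Longrightarrow> (norm w)\<^sup>2 \<le> 2 * (norm m)\<^sup>2"
proof -
  define I where "I = (INF m\<in>M. (norm m)\<^sup>2)"
  have ge: "lam\<^sup>2 \<le> (norm m)\<^sup>2" if "m \<in> M" for m
    using assms that by (simp add: power_mono)
  have bdd: "bdd_below ((\<lambda>m. (norm m)\<^sup>2) ` M)"
    by (intro bdd_belowI[of _ 0]) auto
  have "lam\<^sup>2 \<le> I"
    unfolding I_def using ge assms(1) by (intro cINF_greatest)
  then have "I < 2 * I"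
    using \<open>lam > 0\<close> by (smt (verit) zero_less_power)
  then obtain w where w: "w \<in> M" "(norm w)\<^sup>2 < 2 * I"
    using assms(1) bdd unfolding I_def by (metis (mono_tags, lifting) cINF_less_iff)
  have "I \<le> (norm m)\<^sup>2" if "m \<in> M" for m
    unfolding I_def using bdd that by (rule cINF_lower)
  with w that show ?thesis by fastforce
qed

text \<open>
  The phase \<open>\<psi>\<close>, additive modulo \<open>\<int>\<close>, is what makes the induction work: after projecting along a
  nearly shortest vector \<open>w\<close>, the condition on the remaining vectors is inhomogeneous even if
  \<open>\<psi> = 0\<close>.
\<close>

lemma transference:
  fixes V M :: "'a::euclidean_space set" and \<psi> :: "'a \<Rightarrow> real"
  assumes "dim V \<le> n" "subspace V" "M \<subseteq> V" "0 \<in> M"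
    and "\<And>a b. a \<in> M \<Longrightarrow> b \<in> M \<Longrightarrow> a - b \<in> M"
    and "lam > 0" "\<And>m. m \<in> M \<Longrightarrow> m \<noteq> 0 \<Longrightarrow> lam \<le> norm m"
    and "\<And>a b. a \<in> M \<Longrightarrow> b \<in> M \<Longrightarrow> \<psi> (a - b) - \<psi> a + \<psi> b \<in> \<int>"
    and "x \<in> V"
  shows "\<exists>l\<in>V. norm (x - l) \<le> 3 ^ n / lam \<and> (\<forall>m\<in>M. m \<bullet> l - \<psi> m \<in> \<int>)"
  using assms
proof (induction n arbitrary: V M lam \<psi> x)
  case 0
  then have "V = {0}"
    by (metis dim_eq_0 le_zero_eq subset_singletonD subspace_0 empty_iff)
  moreover from this have "M = {0}" using "0.prems" by auto
  moreover have "\<psi> 0 \<in> \<int>" using "0.prems"(8)[of 0 0] "0.prems"(4) by simp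
  ultimately show ?case using "0.prems" by (intro bexI[of _ x]) auto
next
  case (Suc n)
  note M_diff = Suc.prems(5) and M_lam = Suc.prems(7) and \<psi> = Suc.prems(8)
  show ?case
  proof (cases "M = {0}")
    case True
    moreover have "\<psi> 0 \<in> \<int>" using \<psi>[of 0 0] Suc.prems(4) by simp
    ultimately show ?thesis using Suc.prems by (intro bexI[of _ x]) auto
  next
    case False
    with Suc.prems(4) have "M - {0} \<noteq> {}" by blast
    from nearly_shortest_vector[OF this Suc.prems(6)] M_lam
    obtain w where w': "w \<in> M - {0}"
      and w_min': "\<And>m. m \<in> M - {0} \<Longrightarrow> (norm w)\<^sup>2 \<le> 2 * (norm m)\<^sup>2"
      by (metis DiffE insertI1)
    have w: "w \<in> M" "w \<noteq> 0" using w' by auto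
    have w_min: "(norm w)\<^sup>2 \<le> 2 * (norm m)\<^sup>2" if "m \<in> M" "m \<noteq> 0" for m
      using w_min' that by simp
    define c where "c v = (v \<bullet> w) / (norm w)\<^sup>2" for v
    define p where "p v = v - c v *\<^sub>R w" for v
    have nw: "norm w > 0" using w by simp
    have c_diff: "c (a - b) = c a - c b" for a b
      by (simp add: c_def inner_diff_left diff_divide_distrib)
    have c_scale: "c (k *\<^sub>R w) = k" for k
      using nw by (simp add: c_def power2_norm_eq_inner)
    have p_diff: "p (a - b) = p a - p b" for a b
      by (simp add: p_def c_diff algebra_simps)
    have p_perp: "p v \<bullet> w = 0" for v
      using nw by (simp add: p_def c_def inner_diff_left power2_norm_eq_inner)
    have p_scale: "p (v - k *\<^sub>R w) = p v" for v k
      by (simp add: p_def c_diff c_scale algebra_simps)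
    have norm_split: "(norm v)\<^sup>2 = (norm (p v))\<^sup>2 + (c v)\<^sup>2 * (norm w)\<^sup>2" for v
    proof -
      have "orthogonal (p v) (c v *\<^sub>R w)"
        using p_perp by (simp add: orthogonal_def)
      from norm_add_Pythagorean[OF this] show ?thesis
        by (simp add: p_def power_mult_distrib)
    qed
    have M_add: "a + b \<in> M" if "a \<in> M" "b \<in> M" for a b
      using M_diff[OF that(1) M_diff[OF Suc.prems(4) that(2)]] by simp
    have nat_mult: "of_nat k *\<^sub>R w \<in> M" for k
      by (induction k) (auto simp: Suc.prems(4) scaleR_add_left intro: M_add w)
    have int_mult: "of_int k *\<^sub>R w \<in> M" for k
    proof (cases "k \<ge> 0")
      case True then show ?thesis using nat_mult[of "nat k"] by simp
    next
      case False then show ?thesis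
        using M_diff[OF Suc.prems(4) nat_mult[of "nat (- k)"]] by simp
    qed
    have reduce: "\<exists>k::int. m - of_int k *\<^sub>R w \<in> M \<and> (c (m - of_int k *\<^sub>R w))\<^sup>2 \<le> 1 / 4"
      if "m \<in> M" for m
    proof -
      obtain k :: int where "\<bar>c m - k\<bar> \<le> 1 / 2" by (rule nearest_integer)
      then have "\<bar>c m - k\<bar>\<^sup>2 \<le> (1 / 2)\<^sup>2" by (rule power_mono) simp
      then show ?thesis
        using M_diff[OF that int_mult] by (auto simp: c_diff c_scale power2_eq_square)
    qed
    \<comment> \<open>Reduction modulo \<open>w\<close> keeps the projection, and near-minimality
      gives |w|^2 <= 2 |p m|^2 + |w|^2 / 2, so |p m| >= |w| / 2. This is where \<open>lam\<close> is
      halved.\<close>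
    have p_ge: "lam / 2 \<le> norm (p m)" if "m \<in> M" "p m \<noteq> 0" for m
    proof -
      from reduce[OF that(1)] obtain k :: int
        where k: "m - of_int k *\<^sub>R w \<in> M" "(c (m - of_int k *\<^sub>R w))\<^sup>2 \<le> 1 / 4"
        by blast
      let ?m = "m - of_int k *\<^sub>R w"
      have "p ?m \<noteq> 0" using that by (simp add: p_scale)
      then have "?m \<noteq> 0" by (metis p_diff diff_self)
      then have "(norm w)\<^sup>2 \<le> 2 * ((norm (p m))\<^sup>2 + (c ?m)\<^sup>2 * (norm w)\<^sup>2)"
        using w_min[OF k(1)] norm_split[of ?m] by (simp add: p_scale)
      moreover have "(c ?m)\<^sup>2 * (norm w)\<^sup>2 \<le> 1 / 4 * (norm w)\<^sup>2"
        using k(2) by (rule mult_right_mono) simp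
      moreover have "lam\<^sup>2 \<le> (norm w)\<^sup>2"
        using M_lam[OF w] Suc.prems(6) by (simp add: power_mono)
      ultimately have "(lam / 2)\<^sup>2 \<le> (norm (p m))\<^sup>2"
        by (simp add: power_divide)
      then show ?thesis by (rule power2_le_imp_le) simp
    qed
    \<comment> \<open>A reduced nonzero vector parallel to \<open>w\<close> would give |w|^2 <=
      |w|^2 / 2. Hence \<open>p\<close> identifies vectors of \<open>M\<close> only along integer
      multiples of \<open>w\<close>.\<close>
    have p_zero: "\<exists>k::int. m = of_int k *\<^sub>R w" if "m \<in> M" "p m = 0" for m
    proof -
      from reduce[OF that(1)] obtain k :: int
        where k: "m - of_int k *\<^sub>R w \<in> M" "(c (m - of_int k *\<^sub>R w))\<^sup>2 \<le> 1 / 4"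
        by blast
      let ?m = "m - of_int k *\<^sub>R w"
      have "?m = 0"
      proof (rule ccontr)
        assume "?m \<noteq> 0"
        then have "(norm w)\<^sup>2 \<le> 2 * ((c ?m)\<^sup>2 * (norm w)\<^sup>2)"
          using w_min[OF k(1)] norm_split[of ?m] that(2) by (simp add: p_scale)
        also have "\<dots> \<le> 2 * (1 / 4 * (norm w)\<^sup>2)"
          using k(2) by (intro mult_left_mono mult_right_mono) auto
        finally show False using nw by simp
      qed
      then show ?thesis by auto
    qed
    \<comment> \<open>the nearest admissible level of the functional given by \<open>w\<close>\<close>
    obtain j :: int where j: "\<bar>x \<bullet> w - \<psi> w - j\<bar> \<le> 1 / 2"
      by (rule nearest_integer)
    define k where "k = \<psi> w + j"
    define V' where "V' = {v \<in> V. v \<bullet> w = 0}"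
    have wV: "w \<in> V" using w Suc.prems(3) by blast
    have pV: "p v \<in> V'" if "v \<in> V" for v
      using that wV Suc.prems(2) p_perp
      by (auto simp: V'_def p_def[abs_def] intro: subspace_diff subspace_mul)
    have sub: "subspace V'"
      using Suc.prems(2) by (auto simp: V'_def subspace_def inner_add_left)
    have "w \<notin> V'" using w by (simp add: V'_def)
    moreover have "V' \<subseteq> V" by (auto simp: V'_def)
    ultimately have "V' \<subset> V" using wV by blast
    then have "dim V' < dim V"
      using sub Suc.prems(2) by (metis dim_psubset span_eq_iff)
    then have dim: "dim V' \<le> n" using Suc.prems(1) by simp
    define M' where "M' = p ` M"
    define lift where "lift u = (SOME m. m \<in> M \<and> p m = u)" for u
    \<comment> \<open>For l = l' + (k / |w|^2) w with l' orthogonal to \<open>w\<close>, the product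
      of m and l is that of p m and l' plus c m * k; \<open>\<psi>'\<close> is the phase left over
      for p m. Since \<open>\<psi> w - k\<close> is an integer, it does not depend on the lift
      modulo integers (\<open>level\<close>).\<close>
    define \<psi>' where "\<psi>' u = \<psi> (lift u) - c (lift u) * k" for u
    have lift: "lift u \<in> M" "p (lift u) = u" if "u \<in> M'" for u
    proof -
      have "\<exists>m. m \<in> M \<and> p m = u" using that by (auto simp: M'_def)
      then have "lift u \<in> M \<and> p (lift u) = u" unfolding lift_def by (rule someI_ex)
      then show "lift u \<in> M" "p (lift u) = u" by auto
    qed
    have \<psi>0: "\<psi> 0 \<in> \<int>" using \<psi>[of 0 0] Suc.prems(4) by simp
    have \<psi>_nat: "\<psi> (of_nat i *\<^sub>R w) - of_nat i * \<psi> w \<in> \<int>" for i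
    proof (induction i)
      case (Suc i)
      have "\<psi> (of_nat (Suc i) *\<^sub>R w - w) - \<psi> (of_nat (Suc i) *\<^sub>R w) + \<psi> w \<in> \<int>"
        using \<psi> nat_mult w by blast
      from Ints_diff[OF Suc this] show ?case
        by (simp add: algebra_simps)
    qed (use \<psi>0 in simp)
    have \<psi>_int: "\<psi> (of_int i *\<^sub>R w) - of_int i * \<psi> w \<in> \<int>" for i
    proof (cases "i \<ge> 0")
      case True then show ?thesis using \<psi>_nat[of "nat i"] by simp
    next
      case False
      have "\<psi> (0 - of_nat (nat (- i)) *\<^sub>R w) - \<psi> 0 + \<psi> (of_nat (nat (- i)) *\<^sub>R w) \<in> \<int>"
        using \<psi> nat_mult Suc.prems(4) by blast
      from Ints_diff[OF Ints_add[OF this \<psi>0] \<psi>_nat[of "nat (- i)"]] False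
      show ?thesis by (simp add: algebra_simps)
    qed
    have level: "\<psi> a - c a * k - (\<psi> b - c b * k) \<in> \<int>" if "a \<in> M" "b \<in> M" "p a = p b" for a b
    proof -
      have "p (a - b) = 0" using that by (simp add: p_diff)
      from p_zero[OF M_diff[OF that(1,2)] this]
      obtain i :: int where i: "a - b = of_int i *\<^sub>R w" by blast
      have "c a - c b = i" using c_scale[of i] by (simp add: c_diff flip: i)
      then have "(c a - c b) * k = i * (\<psi> w + j)" by (simp add: k_def)
      then have *: "c a * k - c b * k = i * \<psi> w + i * j"
        by (simp add: left_diff_distrib distrib_left)
      have "\<psi> (of_int i *\<^sub>R w) - \<psi> a + \<psi> b \<in> \<int>" using \<psi>[OF that(1,2)] i by simp
      from Ints_diff[OF Ints_diff[OF \<psi>_int[of i] this] Ints_of_int[of "i * j"]] *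
      show ?thesis by (simp add: algebra_simps)
    qed
    have \<psi>': "\<psi>' (a - b) - \<psi>' a + \<psi>' b \<in> \<int>" and M'_diff: "a - b \<in> M'"
      if "a \<in> M'" "b \<in> M'" for a b
    proof -
      have *: "lift a - lift b \<in> M" "p (lift a - lift b) = a - b"
        using that lift M_diff by (auto simp: p_diff)
      then show "a - b \<in> M'" by (metis M'_def imageI)
      then have "\<psi> (lift (a - b)) - c (lift (a - b)) * k
          - (\<psi> (lift a - lift b) - c (lift a - lift b) * k) \<in> \<int>"
        by (intro level) (use lift * in auto)
      from Ints_add[OF this \<psi>[OF lift(1) lift(1), OF that]]
      show "\<psi>' (a - b) - \<psi>' a + \<psi>' b \<in> \<int>"
        by (simp add: \<psi>'_def c_diff algebra_simps)
    qed
    have "p 0 = 0" by (simp add: p_def c_def)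
    then have "0 \<in> M'" using Suc.prems(4) by (force simp: M'_def)
    moreover have "M' \<subseteq> V'" using pV Suc.prems(3) by (auto simp: M'_def)
    moreover have "lam / 2 \<le> norm u" if "u \<in> M'" "u \<noteq> 0" for u
      using p_ge that by (auto simp: M'_def)
    moreover have "lam / 2 > 0" using Suc.prems(6) by simp
    ultimately have "\<exists>l'\<in>V'. norm (p x - l') \<le> 3 ^ n / (lam / 2) \<and>
        (\<forall>m\<in>M'. m \<bullet> l' - \<psi>' m \<in> \<int>)"
      using M'_diff \<psi>' pV[OF Suc.prems(9)] by (intro Suc.IH[OF dim sub])
    then obtain l' where l': "l' \<in> V'" "norm (p x - l') \<le> 3 ^ n / (lam / 2)"
        "\<And>m. m \<in> M' \<Longrightarrow> m \<bullet> l' - \<psi>' m \<in> \<int>"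
      by blast
    define l where "l = l' + (k / (norm w)\<^sup>2) *\<^sub>R w"
    have "l \<in> V" using l'(1) wV Suc.prems(2)
      by (auto simp: l_def V'_def intro: subspace_add subspace_mul)
    moreover have "norm (x - l) \<le> 3 ^ Suc n / lam"
    proof -
      have "x - l = (p x - l') + ((x \<bullet> w - k) / (norm w)\<^sup>2) *\<^sub>R w"
        by (simp add: l_def p_def c_def diff_divide_distrib algebra_simps)
      then have "norm (x - l) \<le> norm (p x - l') + \<bar>x \<bullet> w - k\<bar> / (norm w)\<^sup>2 * norm w"
        using norm_triangle_ineq[of "p x - l'" "((x \<bullet> w - k) / (norm w)\<^sup>2) *\<^sub>R w"]
        by simp
      also have "\<bar>x \<bullet> w - k\<bar> / (norm w)\<^sup>2 * norm w = \<bar>x \<bullet> w - k\<bar> / norm w"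
        by (simp add: power2_eq_square)
      also have "\<dots> \<le> (1 / 2) / lam"
        using j M_lam[OF w] Suc.prems(6) by (intro frac_le) (auto simp: k_def algebra_simps)
      also have "norm (p x - l') + (1 / 2) / lam \<le> 3 ^ n / (lam / 2) + 1 / lam"
        using l'(2) Suc.prems(6) by (intro add_mono divide_right_mono) auto
      \<comment> \<open>Origin of the base 3: halving \<open>lam\<close> doubles the inductive
        bound, the component along \<open>w\<close> adds at most \<open>1 / lam\<close>, and 2 * 3^n
        + 1 <= 3^(n+1).\<close>
      also have "\<dots> = (2 * 3 ^ n + 1) / lam" by (simp add: add_divide_distrib)
      also have "\<dots> \<le> 3 ^ Suc n / lam"
        using Suc.prems(6) by (intro divide_right_mono) auto
      finally show ?thesis by simp
    qed
    moreover have "m \<bullet> l - \<psi> m \<in> \<int>" if "m \<in> M" for m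
    proof -
      have pm: "p m \<in> M'" using that by (simp add: M'_def)
      have "m \<bullet> l' = p m \<bullet> l'"
        using l'(1) by (simp add: p_def inner_diff_left V'_def inner_commute[of w])
      then have "m \<bullet> l = p m \<bullet> l' + c m * k"
        by (simp add: l_def inner_add_right c_def)
      moreover have "\<psi> (lift (p m)) - c (lift (p m)) * k - (\<psi> m - c m * k) \<in> \<int>"
        using level lift[OF pm] that by blast
      ultimately show ?thesis
        using Ints_add[OF l'(3)[OF pm]] by (fastforce simp: \<psi>'_def algebra_simps)
    qed
    ultimately show ?thesis by blast
  qed
qed

section \<open>Covering radius and dual lattice\<close>

definition dual_lattice :: "(real^'n) set \<Rightarrow> (real^'n) set" where
  "dual_lattice L = {w. \<forall>l\<in>L. w \<bullet> l \<in> \<int>}"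

text \<open>\<open>D\<close> is a parameter so that one openness proof (\<open>openin_hits\<close>)
  serves both the lattice, for the covering sublevels, and its dual, for the slabs.\<close>

definition hits :: "((real^'n) set \<Rightarrow> (real^'n) set) \<Rightarrow> (real^'n) set \<Rightarrow> (real^'n) set set" where
  "hits D B = {L \<in> Omega0. D L \<inter> B \<noteq> {}}"

abbreviation "lattice_hits \<equiv> hits (\<lambda>L. L)"
abbreviation "dual_hits \<equiv> hits dual_lattice"

lemma SL_real_inverse:
  fixes h :: "real^'n^'n"
  assumes "h \<in> SL_real"
  obtains h' where "h' \<in> SL_real" "h ** h' = mat 1" "h' ** h = mat 1"
proof -
  have "invertible h" using assms by (simp add: SL_real_def invertible_det_nz)
  then obtain h' where h': "h ** h' = mat 1" "h' ** h = mat 1"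
    unfolding invertible_def by blast
  have "det h * det h' = 1" by (metis h'(1) det_mul det_I)
  then have "h' \<in> SL_real" using assms by (simp add: SL_real_def)
  with h' that show ?thesis by blast
qed

lemma inner_matrix_vector_mult:
  fixes A :: "real^'n^'m"
  shows "w \<bullet> (A *v z) = (transpose A *v w) \<bullet> z"
  by (simp add: dot_lmul_matrix)

lemma dual_lattice_of:
  "dual_lattice (lattice_of h) = {w. transpose h *v w \<in> int_vectors}"
proof -
  have "(\<forall>l\<in>lattice_of h. w \<bullet> l \<in> \<int>) \<longleftrightarrow> transpose h *v w \<in> int_vectors" for w
  proof
    assume *: "\<forall>l\<in>lattice_of h. w \<bullet> l \<in> \<int>"
    have "(transpose h *v w) $ i \<in> \<int>" for i
    proof -
      have "axis i 1 \<in> (int_vectors :: (real^'a) set)"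
        by (auto simp: int_vectors_def axis_def)
      then have "h *v axis i 1 \<in> lattice_of h" by (auto simp: lattice_of_def)
      with * have "w \<bullet> (h *v axis i 1) \<in> \<int>" by blast
      then show ?thesis unfolding inner_matrix_vector_mult by (simp add: inner_axis)
    qed
    then show "transpose h *v w \<in> int_vectors" by (simp add: int_vectors_def)
  next
    assume *: "transpose h *v w \<in> int_vectors"
    then have "(transpose h *v w) \<bullet> z \<in> \<int>" if "z \<in> int_vectors" for z
      using that by (auto simp: inner_vec_def int_vectors_def intro!: Ints_sum Ints_mult)
    then show "\<forall>l\<in>lattice_of h. w \<bullet> l \<in> \<int>"
      by (auto simp: lattice_of_def inner_matrix_vector_mult)
  qed
  then show ?thesis by (simp add: dual_lattice_def)
qed

text \<open>The rows of the inverse of \<open>h\<close> are dual vectors, so integrality against the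
  dual makes each coordinate of the inverse applied to \<open>l\<close> an integer.\<close>

lemma double_dual_lattice:
  fixes h :: "real^'n^'n"
  assumes "h \<in> SL_real" and "\<And>w. w \<in> dual_lattice (lattice_of h) \<Longrightarrow> w \<bullet> l \<in> \<int>"
  shows "l \<in> lattice_of h"
proof -
  obtain h' where h': "h ** h' = mat 1" "h' ** h = mat 1"
    using assms(1) by (rule SL_real_inverse)
  have "(h' *v l) $ i \<in> \<int>" for i
  proof -
    have "transpose h *v (transpose h' *v axis i 1) = axis i 1"
      by (metis h'(2) matrix_transpose_mul matrix_vector_mul_assoc matrix_vector_mul_lid transpose_mat)
    then have "transpose h' *v axis i 1 \<in> dual_lattice (lattice_of h)"
      by (auto simp: dual_lattice_of int_vectors_def axis_def)
    from assms(2)[OF this] show ?thesis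
      by (metis inner_axis' inner_matrix_vector_mult mult_1 real_inner_1_left transpose_transpose inner_real_def)
  qed
  moreover have "l = h *v (h' *v l)" by (simp add: matrix_vector_mul_assoc h')
  ultimately show ?thesis unfolding lattice_of_def int_vectors_def by blast
qed

text \<open>Transference with phase 0 for the dual lattice: the point found pairs integrally with
  the dual, so biduality puts it into the lattice.\<close>

lemma lattice_covering:
  fixes h :: "real^'n^'n"
  assumes "h \<in> SL_real" "lam > 0"
    and "\<And>w. w \<in> dual_lattice (lattice_of h) \<Longrightarrow> w \<noteq> 0 \<Longrightarrow> lam \<le> norm w"
  shows "\<exists>l\<in>lattice_of h. norm (x - l) \<le> 3 ^ CARD('n) / lam"
proof -
  let ?M = "dual_lattice (lattice_of h)"
  have "\<exists>l\<in>UNIV. norm (x - l) \<le> 3 ^ CARD('n) / lam \<and> (\<forall>m\<in>?M. m \<bullet> l - (\<lambda>_. 0) m \<in> \<int>)"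
    using assms(2,3)
    by (intro transference) (auto simp: dual_lattice_def inner_diff_left)
  then show ?thesis using double_dual_lattice[OF assms(1)] by auto
qed

text \<open>\<open>transpose h\<close> sends a nonzero dual vector to a nonzero integer vector,
  which has norm at least 1.\<close>

lemma dual_lattice_min:
  fixes h :: "real^'n^'n"
  assumes "h \<in> SL_real"
  obtains lam where "lam > 0" "\<And>w. w \<in> dual_lattice (lattice_of h) \<Longrightarrow> w \<noteq> 0 \<Longrightarrow> lam \<le> norm w"
proof -
  obtain K where K: "K > 0" "\<And>w. norm (transpose h *v w) \<le> norm w * K"
    using bounded_linear.pos_bounded[OF matrix_vector_mul_bounded_linear[of "transpose h"]] by blast
  have "1 / K \<le> norm w" if "w \<in> dual_lattice (lattice_of h)" "w \<noteq> 0" for w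
  proof -
    have "invertible (transpose h)" using assms
      by (simp add: SL_real_def invertible_det_nz det_transpose)
    then have "transpose h *v w \<noteq> 0"
      using that(2) by (metis invertible_def matrix_left_invertible_ker)
    then obtain i where "(transpose h *v w) $ i \<noteq> 0" by (auto simp: vec_eq_iff)
    moreover have "(transpose h *v w) $ i \<in> \<int>"
      using that(1) unfolding dual_lattice_of int_vectors_def by blast
    ultimately have "1 \<le> \<bar>(transpose h *v w) $ i\<bar>" by (simp add: Ints_nonzero_abs_ge1)
    also have "\<dots> \<le> norm w * K"
      using component_le_norm_cart K(2) order_trans by blast
    finally show ?thesis using K(1) by (simp add: field_simps)
  qed
  with that[of "1 / K"] K(1) show ?thesis by simp
qed

text \<open>The covering condition of \<open>covering_radius\<close> for \<open>t > 0\<close>,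
  cleared of the scaling so that monotonicity in \<open>t\<close> is immediate.\<close>

definition simplex_covers :: "real \<Rightarrow> (real^'n) set \<Rightarrow> bool" where
  "simplex_covers t L \<longleftrightarrow> (\<forall>y. \<exists>l\<in>L. (\<forall>i. l $ i \<le> y $ i) \<and> (\<Sum>i\<in>UNIV. (y - l) $ i) \<le> t)"

lemma simplex_covers_mono: "simplex_covers s L \<Longrightarrow> s \<le> t \<Longrightarrow> simplex_covers t L"
  unfolding simplex_covers_def by (meson order_trans)

lemma simplex_covers_iff:
  fixes L :: "(real^'n) set"
  assumes "t > 0"
  shows "{t *\<^sub>R x + l | x l. x \<in> std_simplex \<and> l \<in> L} = UNIV \<longleftrightarrow> simplex_covers t L"
proof -
  have "(\<exists>x l. y = t *\<^sub>R x + l \<and> x \<in> std_simplex \<and> l \<in> L) \<longleftrightarrow>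
      (\<exists>l\<in>L. (\<forall>i. l $ i \<le> y $ i) \<and> (\<Sum>i\<in>UNIV. (y - l) $ i) \<le> t)" for y
  proof
    assume "\<exists>x l. y = t *\<^sub>R x + l \<and> x \<in> std_simplex \<and> l \<in> L"
    then obtain x l where x: "y = t *\<^sub>R x + l" "x \<in> std_simplex" "l \<in> L" by blast
    moreover have "(\<Sum>i\<in>UNIV. (y - l) $ i) = t * (\<Sum>i\<in>UNIV. x $ i)"
      by (simp add: x(1) sum_distrib_left)
    ultimately show "\<exists>l\<in>L. (\<forall>i. l $ i \<le> y $ i) \<and> (\<Sum>i\<in>UNIV. (y - l) $ i) \<le> t"
      using assms by (intro bexI[of _ l]) (auto simp: std_simplex_def mult_le_cancel_left2)
  next
    assume "\<exists>l\<in>L. (\<forall>i. l $ i \<le> y $ i) \<and> (\<Sum>i\<in>UNIV. (y - l) $ i) \<le> t"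
    then obtain l where l: "l \<in> L" "\<And>i. l $ i \<le> y $ i" "(\<Sum>i\<in>UNIV. (y - l) $ i) \<le> t" by blast
    have "(\<Sum>i\<in>UNIV. ((1 / t) *\<^sub>R (y - l)) $ i) = (\<Sum>i\<in>UNIV. (y - l) $ i) / t"
      by (simp add: sum_divide_distrib)
    also have "\<dots> \<le> 1" using l(3) assms by simp
    finally have "(1 / t) *\<^sub>R (y - l) \<in> std_simplex"
      using l(2) assms by (auto simp: std_simplex_def)
    moreover have "y = t *\<^sub>R ((1 / t) *\<^sub>R (y - l)) + l" using assms by simp
    ultimately show "\<exists>x l. y = t *\<^sub>R x + l \<and> x \<in> std_simplex \<and> l \<in> L" using l(1) by blast
  qed
  then show ?thesis unfolding simplex_covers_def by blast
qed

lemma simplex_covers_of_ball: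
  fixes L :: "(real^'n) set"
  assumes "\<And>x. \<exists>l\<in>L. norm (x - l) \<le> r"
  shows "simplex_covers (2 * r * CARD('n)) L"
  unfolding simplex_covers_def
proof
  fix y :: "real^'n"
  \<comment> \<open>Aiming at \<open>y\<close> lowered by \<open>r\<close> in every coordinate puts
    the lattice point below \<open>y\<close>, with gaps of at most 2 r.\<close>
  obtain l where l: "l \<in> L" "norm (y - (\<chi> i. r) - l) \<le> r" using assms by blast
  have b: "\<bar>y $ i - r - l $ i\<bar> \<le> r" for i
    using component_le_norm_cart[of "y - (\<chi> i. r) - l" i] l(2) by simp
  have "l $ i \<le> y $ i" and "(y - l) $ i \<le> 2 * r" for i
    using b[of i] by (auto simp: abs_le_iff)
  moreover from this have "(\<Sum>i\<in>UNIV. (y - l) $ i) \<le> of_nat CARD('n) * (2 * r)"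
    by (intro sum_bounded_above)
  ultimately show "\<exists>l\<in>L. (\<forall>i. l $ i \<le> y $ i) \<and> (\<Sum>i\<in>UNIV. (y - l) $ i) \<le> 2 * r * CARD('n)"
    using l(1) by (intro bexI[of _ l]) (auto simp: algebra_simps)
qed

text \<open>Quantifying over \<open>t > R\<close> avoids showing that the infimum is attained. Its
  defining set must be nonempty, as \<open>Inf {}\<close> says nothing; this comes from
  \<open>dual_lattice_min\<close>.\<close>

lemma covering_radius_le_iff:
  fixes L :: "(real^'n) set"
  assumes "L \<in> Omega0" "R > 0"
  shows "covering_radius L \<le> R \<longleftrightarrow> (\<forall>t>R. simplex_covers t L)"
proof -
  define S where "S = {t. t > 0 \<and> simplex_covers t L}"
  have "{t. t > 0 \<and> {t *\<^sub>R x + l | x l. x \<in> std_simplex \<and> l \<in> L} = UNIV} = S"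
    unfolding S_def using simplex_covers_iff by blast
  then have Q: "covering_radius L = Inf S" by (simp add: covering_radius_def)
  have bdd: "bdd_below S" by (intro bdd_belowI[of _ 0]) (auto simp: S_def)
  obtain h where h: "h \<in> SL_real" "L = lattice_of h" using assms(1) by (auto simp: Omega0_def)
  obtain lam where lam: "lam > 0"
      "\<And>w. w \<in> dual_lattice (lattice_of h) \<Longrightarrow> w \<noteq> 0 \<Longrightarrow> lam \<le> norm w"
    using dual_lattice_min[OF h(1)] by blast
  have "simplex_covers (2 * (3 ^ CARD('n) / lam) * CARD('n)) L"
    unfolding h(2) by (intro simplex_covers_of_ball lattice_covering h lam)
  moreover have "2 * (3 ^ CARD('n) / lam) * CARD('n) > 0" using lam(1) by simp
  ultimately have ne: "S \<noteq> {}" unfolding S_def by blast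
  show ?thesis
  proof
    assume *: "covering_radius L \<le> R"
    show "\<forall>t>R. simplex_covers t L"
    proof (intro allI impI)
      fix t assume "t > R"
      then have "Inf S < t" using * Q by simp
      then obtain s where "s \<in> S" "s < t" using ne cInf_lessD by blast
      then show "simplex_covers t L" using simplex_covers_mono by (force simp: S_def)
    qed
  next
    assume *: "\<forall>t>R. simplex_covers t L"
    have "Inf S \<le> t" if "t > R" for t
      using that * assms(2) bdd by (intro cInf_lower) (auto simp: S_def)
    then show "covering_radius L \<le> R" unfolding Q by (rule dense_ge)
  qed
qed

lemma covering_radius_le:
  fixes L :: "(real^'n) set"
  assumes "L \<in> Omega0" "R > 0"
    and "\<And>w. w \<in> dual_lattice L \<Longrightarrow> w \<noteq> 0 \<Longrightarrow> 2 * 3 ^ CARD('n) * CARD('n) / R \<le> norm w"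
  shows "covering_radius L \<le> R"
proof -
  obtain h where h: "h \<in> SL_real" "L = lattice_of h" using assms(1) by (auto simp: Omega0_def)
  let ?lam = "2 * 3 ^ CARD('n) * CARD('n) / R"
  have "?lam > 0" using assms(2) by simp
  then have "simplex_covers (2 * (3 ^ CARD('n) / ?lam) * CARD('n)) L"
    using assms(3) unfolding h(2) by (intro simplex_covers_of_ball lattice_covering h)
  moreover have "2 * (3 ^ CARD('n) / ?lam) * CARD('n) = R" by simp
  ultimately show ?thesis
    using covering_radius_le_iff[OF assms(1,2)] simplex_covers_mono less_imp_le by metis
qed

text \<open>For \<open>t > 0\<close> the interior of y - t Delta; openness turns being hit by a
  lattice into an open condition.\<close>

definition open_simplex :: "real^'n \<Rightarrow> real \<Rightarrow> (real^'n) set" where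
  "open_simplex y t = {l. (\<forall>i. l $ i < y $ i) \<and> (\<Sum>i\<in>UNIV. (y - l) $ i) < t}"

lemma open_open_simplex: "open (open_simplex y t)"
proof -
  have "open_simplex y t =
      (\<Inter>i. {l. l $ i < y $ i}) \<inter> {l. (\<Sum>i\<in>UNIV. (y - l) $ i) < t}"
    by (auto simp: open_simplex_def)
  then show ?thesis
    by (auto intro!: open_INT open_Int open_Collect_less continuous_intros)
qed

text \<open>Lowering \<open>y\<close> by e / (2 n) in each coordinate makes the coordinate
  inequalities strict and costs only e / 2 in the sum.\<close>

lemma open_simplex_shift:
  fixes y :: "real^'n"
  assumes "e > 0" "(\<forall>i. l $ i \<le> y $ i - e / CARD('n) / 2)"
    "(\<Sum>i\<in>UNIV. (y - (\<chi> i. e / CARD('n) / 2) - l) $ i) \<le> t"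
  shows "l \<in> open_simplex y (t + e)"
proof -
  have p: "e / CARD('n) / 2 > 0" using assms(1) by simp
  have "(\<Sum>i\<in>UNIV. (y - (\<chi> i. e / CARD('n) / 2) - l) $ i) = (\<Sum>i\<in>UNIV. (y - l) $ i) - e / 2"
    by (simp add: sum_subtractf)
  with assms(1,3) have "(\<Sum>i\<in>UNIV. (y - l) $ i) < t + e" by simp
  moreover have "l $ i < y $ i" for i using p assms(2) by (smt (verit))
  ultimately show ?thesis by (simp add: open_simplex_def)
qed

text \<open>Makes two uncountable quantifiers countable, for measurability. Left to right, the slack
  1 / (k + 1) pays for strict inequalities; right to left, \<open>y\<close> gives way to a point of
  \<open>D\<close> just below it, and the two coordinate sums add up to at most
  \<open>t\<close>.\<close>

lemma simplex_covers_iff_dense: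
  fixes D :: "(real^'n) set" and L :: "(real^'n) set"
  assumes "\<And>U. open U \<Longrightarrow> U \<noteq> {} \<Longrightarrow> \<exists>y\<in>D. y \<in> U"
  shows "(\<forall>t>R. simplex_covers t L) \<longleftrightarrow>
    (\<forall>k::nat. \<forall>y\<in>D. L \<inter> open_simplex y (R + inverse (Suc k)) \<noteq> {})"
proof (intro iffI allI impI ballI)
  fix k y assume *: "\<forall>t>R. simplex_covers t L" and "y \<in> D"
  define e where "e = inverse (real (Suc k)) / 2"
  have e: "e > 0" by (simp add: e_def)
  then have "simplex_covers (R + e) L" using * by simp
  then obtain l where "l \<in> L" "(\<forall>i. l $ i \<le> (y - (\<chi> i. e / CARD('n) / 2)) $ i)"
      "(\<Sum>i\<in>UNIV. (y - (\<chi> i. e / CARD('n) / 2) - l) $ i) \<le> R + e"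
    unfolding simplex_covers_def by blast
  then have "l \<in> open_simplex y (R + e + e)" using e by (intro open_simplex_shift) auto
  then show "L \<inter> open_simplex y (R + inverse (Suc k)) \<noteq> {}"
    using \<open>l \<in> L\<close> by (auto simp: e_def add.assoc)
next
  fix t assume *: "\<forall>k::nat. \<forall>y\<in>D. L \<inter> open_simplex y (R + inverse (Suc k)) \<noteq> {}" and "t > R"
  then obtain k where k: "inverse (real (Suc k)) < t - R"
    using reals_Archimedean[of "t - R"] by auto
  define e where "e = t - R - inverse (real (Suc k))"
  have e: "e > 0" using k by (simp add: e_def)
  show "simplex_covers t L"
    unfolding simplex_covers_def
  proof
    fix y :: "real^'n"
    have "y - (\<chi> i. e / CARD('n) / 2) \<in> open_simplex y (0 + e)"
      using e by (intro open_simplex_shift) auto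
    then obtain y' where y': "y' \<in> D" "y' \<in> open_simplex y e"
      using assms[OF open_open_simplex[of y e]] by auto
    then obtain l where l: "l \<in> L" "l \<in> open_simplex y' (R + inverse (Suc k))" using * by blast
    have "(\<Sum>i\<in>UNIV. (y - l) $ i) = (\<Sum>i\<in>UNIV. (y - y') $ i) + (\<Sum>i\<in>UNIV. (y' - l) $ i)"
      by (simp flip: sum.distrib)
    also have "\<dots> \<le> t" using y'(2) l(2) by (auto simp: open_simplex_def e_def)
    finally have "(\<Sum>i\<in>UNIV. (y - l) $ i) \<le> t" .
    moreover have "l $ i \<le> y $ i" for i
      using y'(2) l(2) unfolding open_simplex_def
      by (metis (mono_tags, lifting) mem_Collect_eq less_trans less_imp_le)
    ultimately show "\<exists>l\<in>L. (\<forall>i. l $ i \<le> y $ i) \<and> (\<Sum>i\<in>UNIV. (y - l) $ i) \<le> t"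
      using l(1) by blast
  qed
qed

section \<open>Measurability and invariance\<close>

lemma openin_Omega0_sets:
  assumes "openin Omega0_topology U"
  shows "U \<in> sets Omega0_borel"
proof -
  have "{U. openin Omega0_topology U} \<subseteq> Pow (Omega0 :: (real^'a) set set)"
    using openin_subset topspace_Omega0 by blast
  then show ?thesis using assms by (simp add: Omega0_borel_def sets_measure_of)
qed

lemma openin_SL_preimage:
  assumes "continuous_on SL_real f" "open B"
  shows "openin (top_of_set SL_real) {h \<in> SL_real. f h \<in> B}"
  using continuous_openin_preimage_gen[OF assms] by (simp add: vimage_def Int_def)

lemma openin_hits:
  fixes D :: "(real^'n) set \<Rightarrow> (real^'n) set" and f :: "real^'n^'n \<Rightarrow> real^'n \<Rightarrow> real^'n"
  assumes "\<And>h. h \<in> SL_real \<Longrightarrow> D (lattice_of h) = f h ` int_vectors"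
    and "\<And>z. continuous_on SL_real (\<lambda>h. f h z)" and "open B"
  shows "openin Omega0_topology (hits D B)"
proof -
  have "{h \<in> SL_real. lattice_of h \<in> hits D B} =
      (\<Union>z\<in>int_vectors. {h \<in> SL_real. f h z \<in> B})"
  proof -
    have "lattice_of h \<in> hits D B \<longleftrightarrow> (\<exists>z\<in>int_vectors. f h z \<in> B)" if "h \<in> SL_real" for h
    proof -
      have "lattice_of h \<in> Omega0" using that by (auto simp: Omega0_def)
      then have "lattice_of h \<in> hits D B \<longleftrightarrow> D (lattice_of h) \<inter> B \<noteq> {}" by (simp add: hits_def)
      then show ?thesis unfolding assms(1)[OF that] by auto
    qed
    then show ?thesis by auto
  qed
  moreover have "openin (top_of_set SL_real) {h \<in> SL_real. f h z \<in> B}" for z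
    using assms(2,3) by (rule openin_SL_preimage)
  ultimately have "openin (top_of_set SL_real) {h \<in> SL_real. lattice_of h \<in> hits D B}"
    by (auto intro: openin_Union)
  then show ?thesis by (auto simp: openin_Omega0 Omega0_open_def hits_def)
qed

lemma openin_lattice_hits:
  "open B \<Longrightarrow> openin Omega0_topology (lattice_hits B)"
  by (rule openin_hits[where f = "(*v)"])
    (auto simp: lattice_of_def matrix_vector_mult_def intro!: continuous_intros)

text \<open>Cramer's rule for the system with matrix \<open>transpose h\<close>, without the
  denominator det h = 1. It is polynomial in the entries of \<open>h\<close>, which gives
  continuity.\<close>

definition transpose_solve :: "real^'n^'n \<Rightarrow> real^'n \<Rightarrow> real^'n" where
  "transpose_solve h z = (\<chi> k. det (\<chi> i j. if j = k then z $ i else h $ j $ i))"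

lemma transpose_solve_iff:
  assumes "h \<in> SL_real"
  shows "transpose h *v w = z \<longleftrightarrow> w = transpose_solve h z"
proof -
  have d: "det (transpose h) = 1" using assms by (simp add: SL_real_def det_transpose)
  have "transpose_solve h z =
      (\<chi> k. det (\<chi> i j. if j = k then z $ i else transpose h $ i $ j) / det (transpose h))"
    unfolding d by (simp add: transpose_solve_def transpose_def cong: if_cong)
  then show ?thesis using cramer[of "transpose h" w z] d by simp
qed

lemma openin_dual_hits:
  assumes "open B"
  shows "openin Omega0_topology (dual_hits B)"
proof (rule openin_hits[where f = transpose_solve])
  fix h :: "real^'a^'a" assume "h \<in> SL_real"
  note solve = transpose_solve_iff[OF this]
  show "dual_lattice (lattice_of h) = transpose_solve h ` int_vectors"
  proof (intro subset_antisym subsetI)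
    fix w assume "w \<in> dual_lattice (lattice_of h)"
    then show "w \<in> transpose_solve h ` int_vectors"
      using solve[of w "transpose h *v w"] unfolding dual_lattice_of by blast
  next
    fix w assume "w \<in> transpose_solve h ` int_vectors"
    then obtain z where "z \<in> int_vectors" "transpose h *v w = z" using solve by blast
    then show "w \<in> dual_lattice (lattice_of h)" unfolding dual_lattice_of by blast
  qed
next
  fix z :: "real^'a"
  have "continuous_on SL_real (\<lambda>h::real^'a^'a. if j = k then z $ i else h $ j $ i)" for i j k
    by (cases "j = k") (auto intro!: continuous_intros)
  then show "continuous_on SL_real (\<lambda>h. transpose_solve h z)"
    unfolding transpose_solve_def det_def by (auto intro!: continuous_intros)
qed (rule assms)

text \<open>Lets \<open>Psi\<close> be read as the probability of the complement;
  \<open>measure\<close> is 0 on sets outside the sigma-algebra.\<close>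

lemma covering_sublevel_sets:
  assumes "R > 0"
  shows "(covering_sublevel R :: (real^'n) set set) \<in> sets Omega0_borel"
proof -
  obtain D :: "(real^'n) set" where D: "countable D" "\<And>U. open U \<Longrightarrow> U \<noteq> {} \<Longrightarrow> \<exists>y\<in>D. y \<in> U"
    by (rule countable_dense_setE) blast
  let ?H = "\<lambda>(k::nat, y). lattice_hits (open_simplex y (R + inverse (Suc k)))"
  have "L \<in> covering_sublevel R \<longleftrightarrow> L \<in> Omega0 \<inter> (\<Inter>p\<in>UNIV \<times> D. ?H p)" for L :: "(real^'n) set"
  proof -
    have "covering_radius L \<le> R \<longleftrightarrow>
        (\<forall>k::nat. \<forall>y\<in>D. L \<inter> open_simplex y (R + inverse (Suc k)) \<noteq> {})" if "L \<in> Omega0"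
      unfolding covering_radius_le_iff[OF that assms] by (rule simplex_covers_iff_dense[OF D(2)])
    then show ?thesis by (auto simp: covering_sublevel_def hits_def simp del: of_nat_Suc)
  qed
  then have eq: "covering_sublevel R = Omega0 \<inter> (\<Inter>p\<in>UNIV \<times> D. ?H p)" by blast
  have H: "?H p \<in> sets Omega0_borel" for p :: "nat \<times> (real^'n)"
    by (cases p) (auto intro!: openin_Omega0_sets openin_lattice_hits open_open_simplex)
  have "D \<noteq> {}" using D(2)[of UNIV] by auto
  then have "(\<Inter>p\<in>UNIV \<times> D. ?H p) \<in> sets Omega0_borel"
    using D(1) H \<open>D \<noteq> {}\<close> by (intro sets.countable_INT') auto
  moreover have "Omega0 \<in> sets Omega0_borel"
    using openin_Omega0_sets openin_topspace topspace_Omega0 by metis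
  ultimately show ?thesis unfolding eq by blast
qed

text \<open>An exhaustion that stands in for compact sets: point counts in a large box are uniform
  on each member.\<close>

definition bounded_lattices :: "real \<Rightarrow> (real^'n) set set" where
  "bounded_lattices K = lattice_of ` {h \<in> SL_real. \<forall>i j. \<bar>h $ i $ j\<bar> < K}"

lemma openin_bounded_lattices:
  "openin Omega0_topology (bounded_lattices K :: (real^'n) set set)"
proof -
  let ?U = "{h. \<forall>i j. \<bar>h $ i $ j\<bar> < K} :: (real^'n^'n) set"
  have "?U = (\<Inter>i. \<Inter>j. {h. \<bar>h $ i $ j\<bar> < K})" by auto
  then have "open ?U"
    by (auto intro!: open_INT open_Collect_less continuous_intros)
  \<comment> \<open>A lattice fixes its matrix only up to a right factor from \<open>SL_int\<close>,
    so the preimage is a union of right translates.\<close>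
  have "{g \<in> SL_real. lattice_of g \<in> bounded_lattices K} =
      (\<Union>\<gamma>\<in>SL_int. {g \<in> SL_real. g ** \<gamma> \<in> ?U})" (is "?A = ?B")
  proof
    show "?A \<subseteq> ?B"
      using lattice_of_eq_iff by (fastforce simp: bounded_lattices_def)
    show "?B \<subseteq> ?A"
    proof
      fix g assume "g \<in> ?B"
      then obtain \<gamma> where g: "g \<in> SL_real" "\<gamma> \<in> SL_int" "g ** \<gamma> \<in> ?U" by blast
      then have \<gamma>: "g ** \<gamma> \<in> SL_real" by (simp add: SL_real_def SL_int_def det_mul)
      have "lattice_of g = lattice_of (g ** \<gamma>)"
        using lattice_of_eq_iff[OF g(1) \<gamma>] g(2) by blast
      then show "g \<in> ?A" using g \<gamma> by (auto simp: bounded_lattices_def)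
    qed
  qed
  moreover have "openin (top_of_set SL_real) {g \<in> SL_real. g ** \<gamma> \<in> ?U}" for \<gamma> :: "real^'n^'n"
    using \<open>open ?U\<close>
    by (intro openin_SL_preimage) (auto simp: matrix_matrix_mult_def intro!: continuous_intros)
  ultimately show ?thesis
    by (auto simp: openin_Omega0 Omega0_open_def bounded_lattices_def Omega0_def
        intro!: openin_Union)
qed

lemma UN_bounded_lattices: "(\<Union>k::nat. bounded_lattices (real k)) = (Omega0 :: (real^'n) set set)"
proof -
  have "\<exists>k::nat. \<forall>i j. \<bar>h $ i $ j\<bar> < real k" for h :: "real^'n^'n"
  proof -
    obtain k :: nat where "Max (range (\<lambda>(i, j). \<bar>h $ i $ j\<bar>)) < real k"
      using reals_Archimedean2 by blast
    then have "\<forall>p. (\<lambda>(i, j). \<bar>h $ i $ j\<bar>) p < real k" by simp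
    then show ?thesis by auto
  qed
  then have "SL_real = (\<Union>k::nat. {h \<in> SL_real. \<forall>i j. \<bar>h $ i $ j\<bar> < real k} :: (real^'n^'n) set)"
    by auto
  then show ?thesis unfolding bounded_lattices_def Omega0_def by (metis image_UN)
qed

lemma bounded_lattices_mono: "K \<le> K' \<Longrightarrow> bounded_lattices K \<subseteq> bounded_lattices K'"
  unfolding bounded_lattices_def by (intro image_mono) (auto intro: less_le_trans)

context
  fixes \<mu> :: "(real^'n) set measure"
  assumes \<mu>: "invariant_prob_measure \<mu>"
begin

interpretation prob_space \<mu>
  using \<mu> by (simp add: invariant_prob_measure_def)

lemma invariant_sets: "sets \<mu> = sets Omega0_borel"
  using \<mu> by (simp add: invariant_prob_measure_def)

lemma invariant_space: "space \<mu> = Omega0"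
proof -
  have "space \<mu> = space Omega0_borel" using invariant_sets by (rule sets_eq_imp_space_eq)
  then show ?thesis by (simp add: Omega0_borel_def space_measure_of_conv)
qed

lemma dual_hits_events: "open B \<Longrightarrow> dual_hits B \<in> sets \<mu>"
  by (simp add: invariant_sets openin_Omega0_sets openin_dual_hits)

lemma tendsto_bounded_lattices: "(\<lambda>k. measure \<mu> (bounded_lattices (real k))) \<longlonglongrightarrow> 1"
proof -
  have "(\<lambda>k. measure \<mu> (bounded_lattices (real k))) \<longlonglongrightarrow> measure \<mu> (\<Union>k. bounded_lattices (real k))"
  proof (rule finite_Lim_measure_incseq)
    show "range (\<lambda>k::nat. bounded_lattices (real k)) \<subseteq> sets \<mu>"
      by (auto simp: invariant_sets openin_Omega0_sets openin_bounded_lattices)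
    show "incseq (\<lambda>k::nat. bounded_lattices (real k) :: (real^'n) set set)"
      by (auto simp: incseq_def intro!: bounded_lattices_mono)
  qed
  then show ?thesis by (simp add: UN_bounded_lattices prob_space flip: invariant_space)
qed

text \<open>Passing from L to g L moves the dual by the inverse transpose of g; taking g to be the
  inverse transpose of \<open>k\<close> moves the dual by \<open>k\<close>.\<close>

lemma measure_dual_hits_image:
  assumes "k \<in> SL_real" "open B"
  shows "measure \<mu> (dual_hits ((*v) k ` B)) = measure \<mu> (dual_hits B)"
proof -
  obtain k' where k': "k' \<in> SL_real" "k ** k' = mat 1" "k' ** k = mat 1"
    using assms(1) by (rule SL_real_inverse)
  define g where "g = transpose k'"
  have g: "g \<in> SL_real" using k'(1) by (simp add: g_def SL_real_def det_transpose)
  let ?act = "\<lambda>g L. (\<lambda>v. g *v v) ` (L :: (real^'n) set)"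
  have act: "?act a L \<in> Omega0" if "a \<in> SL_real" "L \<in> Omega0" for a L
  proof -
    obtain h where h: "h \<in> SL_real" "L = lattice_of h"
      using \<open>L \<in> Omega0\<close> by (auto simp: Omega0_def)
    have "?act a L = lattice_of (a ** h)"
      unfolding h(2)
      by (simp add: lattice_of_def image_image matrix_vector_mul_assoc)
    moreover have "a ** h \<in> SL_real" using that(1) h(1) by (simp add: SL_real_def det_mul)
    ultimately show ?thesis by (auto simp: Omega0_def)
  qed
  have dual: "w \<in> dual_lattice (?act a L) \<longleftrightarrow> transpose a *v w \<in> dual_lattice L" for a L w
    by (simp add: dual_lattice_def inner_matrix_vector_mult)
  have "?act g ` dual_hits B = dual_hits ((*v) k ` B)"
  proof (intro subset_antisym subsetI)
    fix L' assume "L' \<in> ?act g ` dual_hits B"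
    then obtain L w where L: "L' = ?act g L" "L \<in> Omega0" "w \<in> dual_lattice L" "w \<in> B"
      by (auto simp: hits_def)
    have "transpose g *v (k *v w) = w" by (simp add: g_def matrix_vector_mul_assoc k')
    then have "k *v w \<in> dual_lattice L'" unfolding L(1) dual using L(3) by simp
    then show "L' \<in> dual_hits ((*v) k ` B)" using L act[OF g] by (auto simp: hits_def)
  next
    fix L' assume "L' \<in> dual_hits ((*v) k ` B)"
    then obtain w where L': "L' \<in> Omega0" "k *v w \<in> dual_lattice L'" "w \<in> B"
      by (auto simp: hits_def)
    let ?L = "?act (transpose k) L'"
    have "transpose k \<in> SL_real" using assms(1) by (simp add: SL_real_def det_transpose)
    then have "?L \<in> Omega0" using L'(1) by (rule act)
    moreover have "w \<in> dual_lattice ?L" unfolding dual transpose_transpose by (rule L'(2))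
    ultimately have "?L \<in> dual_hits B" using L'(3) by (auto simp: hits_def)
    moreover have "g ** transpose k = mat 1"
      unfolding g_def by (metis k'(2) matrix_transpose_mul transpose_mat)
    then have "?act g ?L = L'"
      by (simp add: image_image matrix_vector_mul_assoc del: transpose_matrix_vector)
    ultimately show "L' \<in> ?act g ` dual_hits B" by (metis imageI)
  qed
  then show ?thesis
    using \<mu> g dual_hits_events[OF assms(2)]
    by (metis invariant_prob_measure_def measure_def)
qed

end

section \<open>Counting lattice points by volume\<close>

text \<open>Translation reduces all boxes to those with lower corner 0, on which the elementary
  matrices are checked below.\<close>

lemma measure_matrix_image_sufficient:
  fixes A :: "real^'n^'n"
  assumes "\<bar>det A\<bar> = 1" "S \<in> lmeasurable"
    and "\<And>b. measure lebesgue ((*v) A ` cbox 0 b) = measure lebesgue (cbox 0 b)"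
  shows "(*v) A ` S \<in> lmeasurable \<and> measure lebesgue ((*v) A ` S) = \<bar>det A\<bar> * measure lebesgue S"
proof -
  have "measure lebesgue ((*v) A ` cbox a b) = 1 * measure lebesgue (cbox a b)" for a b
  proof -
    have *: "cbox a b = (+) a ` cbox 0 (b - a)" by (simp flip: cbox_translation)
    have "(*v) A ` cbox a b = (+) (A *v a) ` (*v) A ` cbox 0 (b - a)"
      unfolding * by (simp add: image_image matrix_vector_right_distrib)
    then show ?thesis by (metis * assms(3) measure_translation mult_1)
  qed
  from measure_linear_sufficient[OF matrix_vector_mul_linear assms(2) this] assms(1)
  show ?thesis by simp
qed

text \<open>The library has this only for a well-ordered index type.\<close>

lemma measure_matrix_image:
  fixes A :: "real^'n^'n"
  assumes "S \<in> lmeasurable"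
  shows "(*v) A ` S \<in> lmeasurable"
    and "measure lebesgue ((*v) A ` S) = \<bar>det A\<bar> * measure lebesgue S"
proof -
  define P where "P A \<longleftrightarrow> (\<forall>S\<in>lmeasurable. (*v) A ` S \<in> lmeasurable \<and>
    measure lebesgue ((*v) A ` S) = \<bar>det A\<bar> * measure lebesgue S)" for A :: "real^'n^'n"
  have "P A"
  proof (rule induct_matrix_elementary_alt)
    fix A B :: "real^'n^'n" assume P: "P A" "P B"
    have "(*v) (A ** B) ` S = (*v) A ` (*v) B ` S" for S
      by (simp add: image_image matrix_vector_mul_assoc)
    then show "P (A ** B)"
      using P by (simp add: P_def det_mul abs_mult)
  next
    fix A :: "real^'n^'n" and i assume 0: "row i A = 0"
    then have "(A *v x) $ i = 0" for x
      by (simp add: matrix_vector_mul_component row_def vec_eq_iff inner_vec_def)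
    then have "negligible ((*v) A ` S)" for S
      by (intro negligible_subset[OF negligible_standard_hyperplane_cart[of i]]) auto
    then show "P A" using 0 by (simp add: P_def det_zero_row negligible_iff_measure)
  next
    fix A :: "real^'n^'n" assume D: "\<And>i j. i \<noteq> j \<Longrightarrow> A $ i $ j = 0"
    have "(\<Sum>j\<in>UNIV. A $ i $ j * x $ j) = A $ i $ i * x $ i" for i x
      using D by (subst sum.mono_neutral_right[of _ "{i}"]) auto
    then have "(*v) A = (\<lambda>x. \<chi> k. A $ k $ k * x $ k)"
      by (simp add: fun_eq_iff matrix_vector_mult_def)
    then show "P A"
      by (simp add: P_def measurable_stretch measure_stretch det_diagonal[OF D])
  next
    fix m n :: 'n assume "m \<noteq> n"
    let ?t = "Transposition.transpose m n"
    let ?A = "(\<chi> i j. mat 1 $ i $ ?t j) :: real^'n^'n"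
    have "\<bar>det ?A\<bar> = 1"
      by (simp add: det_permute_columns permutes_swap_id sign_swap_id)
    moreover have "measure lebesgue ((*v) ?A ` cbox 0 b) = measure lebesgue (cbox 0 b)" for b
    proof -
      have A: "?A *v x = (\<chi> i. x $ ?t i)" for x
      proof -
        have "(\<Sum>j\<in>UNIV. (if i = ?t j then 1 else 0) * x $ j) = x $ ?t i" for i
        proof -
          have "i = ?t j \<longleftrightarrow> j = ?t i" for j by (metis transpose_involutory)
          then show ?thesis by (simp add: if_distrib[of "\<lambda>a. a * _"] cong: if_cong)
        qed
        then show ?thesis by (simp add: matrix_vector_mult_def mat_def)
      qed
      have "y \<in> (*v) ?A ` cbox 0 b \<longleftrightarrow> y \<in> cbox 0 (?A *v b)" for y
      proof
        assume "y \<in> (*v) ?A ` cbox 0 b"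
        then show "y \<in> cbox 0 (?A *v b)" by (auto simp: A mem_box_cart)
      next
        assume y: "y \<in> cbox 0 (?A *v b)"
        have 1: "?A *v y \<in> cbox 0 b"
          unfolding A mem_box_cart
        proof (intro allI)
          fix i
          show "(0::real^'n) $ i \<le> (\<chi> i. y $ ?t i) $ i \<and> (\<chi> i. y $ ?t i) $ i \<le> b $ i"
            using y unfolding A mem_box_cart by (auto dest: spec[of _ "?t i"])
        qed
        have "y = ?A *v (?A *v y)" by (simp add: A)
        then show "y \<in> (*v) ?A ` cbox 0 b" using 1 by (rule image_eqI)
      qed
      then have eq: "(*v) ?A ` cbox 0 b = cbox 0 (?A *v b)" by blast
      show ?thesis
      proof (cases "cbox 0 b = {}")
        case False
        then have "cbox 0 (?A *v b) \<noteq> {}" using eq by (metis image_is_empty)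
        then have "measure lborel (cbox 0 (?A *v b)) = (\<Prod>i\<in>UNIV. b $ ?t i)"
          unfolding A by (simp add: content_cbox_cart)
        also have "\<dots> = (\<Prod>i\<in>UNIV. b $ i)"
          using prod.permute[OF permutes_swap_id, of m UNIV n "\<lambda>i. b $ i"] by (simp add: o_def)
        also have "\<dots> = measure lborel (cbox 0 b)" using False by (simp add: content_cbox_cart)
        finally show ?thesis unfolding eq by simp
      qed simp
    qed
    ultimately show "P ?A" unfolding P_def using measure_matrix_image_sufficient by blast
  next
    fix m n :: 'n assume mn: "m \<noteq> n"
    let ?A = "(\<chi> i j. of_bool (i = m \<and> j = n \<or> i = j)) :: real^'n^'n"
    \<comment> \<open>The identity with column \<open>n\<close> replaced, so that
      \<open>cramer_lemma\<close> gives the determinant.\<close>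
    have "?A = (\<chi> i j. if j = n then ((mat 1 :: real^'n^'n) *v (axis n 1 + axis m 1)) $ i
        else (mat 1 :: real^'n^'n) $ i $ j)"
      unfolding matrix_vector_mul_lid using mn by (auto simp: vec_eq_iff axis_def mat_def)
    then have "det ?A = (axis n 1 + axis m 1 :: real^'n) $ n * det (mat 1 :: real^'n^'n)"
      by (simp only: cramer_lemma)
    then have "\<bar>det ?A\<bar> = 1" using mn by (simp add: axis_def)
    moreover have "measure lebesgue ((*v) ?A ` cbox 0 b) = measure lebesgue (cbox 0 b)" for b
    proof (cases "cbox 0 b = {}")
      case False
      have "(\<Sum>j\<in>UNIV. of_bool (i = m \<and> j = n \<or> i = j) * x $ j) =
          (if i = m then x $ m + x $ n else x $ i)" for i and x :: "real^'n"
      proof -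
        have "(\<Sum>j\<in>UNIV. of_bool (i = m \<and> j = n \<or> i = j) * x $ j) =
            (\<Sum>j\<in>UNIV. (if j = i then x $ j else 0) + (if j = n then if i = m then x $ j else 0 else 0))"
          using mn by (intro sum.cong) auto
        then show ?thesis by (simp add: sum.distrib)
      qed
      then have "(*v) ?A = (\<lambda>x. \<chi> i. if i = m then x $ m + x $ n else x $ i)"
        by (simp add: fun_eq_iff matrix_vector_mult_def)
      then show ?thesis using measure_shear_interval[OF mn False] by simp
    qed simp
    ultimately show "P ?A" unfolding P_def using measure_matrix_image_sufficient by blast
  qed
  then show "(*v) A ` S \<in> lmeasurable"
    and "measure lebesgue ((*v) A ` S) = \<bar>det A\<bar> * measure lebesgue S"
    using assms by (auto simp: P_def)
qed

lemma det_bound: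
  fixes A :: "real^'n^'n"
  assumes "\<And>i j. \<bar>A $ i $ j\<bar> \<le> K"
  shows "\<bar>det A\<bar> \<le> fact CARD('n) * K ^ CARD('n)"
proof -
  have "\<bar>of_int (sign p) * (\<Prod>i\<in>UNIV. A $ i $ p i)\<bar> \<le> K ^ CARD('n)" for p
  proof -
    have "\<bar>of_int (sign p) * (\<Prod>i\<in>UNIV. A $ i $ p i)\<bar> = (\<Prod>i\<in>UNIV. \<bar>A $ i $ p i\<bar>)"
      by (simp add: abs_mult abs_prod sign_def)
    also have "\<dots> \<le> (\<Prod>i\<in>(UNIV :: 'n set). K)" using assms by (intro prod_mono) auto
    finally show ?thesis by simp
  qed
  then have "\<bar>det A\<bar> \<le> of_nat (card {p. p permutes (UNIV :: 'n set)}) * K ^ CARD('n)"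
    unfolding det_def by (intro order_trans[OF sum_abs] sum_bounded_above)
  then show ?thesis by (simp add: card_permutations[OF refl])
qed

text \<open>Packing: the inverse transpose of \<open>h\<close> maps the open unit cube to a
  parallelepiped P of volume 1 whose translates by dual vectors are disjoint. The lower bound on
  \<open>T\<close> puts P into the cube of side 2 T, so the translates by \<open>S\<close> lie in
  one of side 4 T.\<close>

lemma card_dual_lattice_le:
  fixes h :: "real^'n^'n"
  assumes h: "h \<in> SL_real" "\<And>i j. \<bar>h $ i $ j\<bar> \<le> K" and K: "1 \<le> K"
    and S: "S \<subseteq> dual_lattice (lattice_of h)" "finite S" "\<And>v i. v \<in> S \<Longrightarrow> \<bar>v $ i\<bar> \<le> T"
    and T: "fact CARD('n) * K ^ CARD('n) \<le> T"
  shows "real (card S) \<le> (4 * T) ^ CARD('n)"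
proof -
  obtain h' where h': "h' \<in> SL_real" "h ** h' = mat 1" "h' ** h = mat 1"
    using h(1) by (rule SL_real_inverse)
  have th: "transpose h *v (transpose h' *v y) = y" for y
    by (metis h'(3) matrix_transpose_mul matrix_vector_mul_assoc matrix_vector_mul_lid transpose_mat)
  let ?Q = "box 0 (\<chi> i. 1) :: (real^'n) set"
  define P where "P = (*v) (transpose h') ` ?Q"
  have P: "P \<in> lmeasurable" unfolding P_def by (intro measure_matrix_image) simp
  have "measure lebesgue ?Q = 1"
  proof -
    have "measure lebesgue ?Q = measure lborel (cbox 0 (\<chi> i. 1) :: (real^'n) set)"
      by (simp add: measure_lborel_box_eq measure_lborel_cbox_eq)
    also have "\<dots> = 1" by (subst content_cbox_cart) (auto simp: interval_ne_empty_cart)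
    finally show ?thesis .
  qed
  then have mP: "measure lebesgue P = 1"
    unfolding P_def using h'(1) by (subst measure_matrix_image) (auto simp: SL_real_def det_transpose)
  have P_bound: "\<bar>y $ i\<bar> \<le> T" and P_cube: "transpose h *v y \<in> ?Q" if y: "y \<in> P" for y i
  proof -
    obtain q where q: "q \<in> ?Q" "y = transpose h' *v q" using y by (auto simp: P_def)
    then show "transpose h *v y \<in> ?Q" by (simp only: th)
    have "y = transpose_solve h q" using transpose_solve_iff[OF h(1)] q(2) th by blast
    \<comment> \<open>Each coordinate is a determinant with entries at most \<open>K\<close>;
      \<open>1 \<le> K\<close> covers the column filled with \<open>q\<close>.\<close>
    moreover have "\<bar>transpose_solve h q $ i\<bar> \<le> fact CARD('n) * K ^ CARD('n)"
      unfolding transpose_solve_def vec_lambda_beta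
    proof (rule det_bound)
      fix a b
      have "\<bar>q $ a\<bar> \<le> K" using q(1) K by (auto simp: mem_box_cart) (smt (verit))
      then show "\<bar>(\<chi> a b. if b = i then q $ a else h $ b $ a) $ a $ b\<bar> \<le> K"
        using h(2) by simp
    qed
    ultimately show "\<bar>y $ i\<bar> \<le> T" using T by simp
  qed
  have "disjoint_family_on (\<lambda>v. (+) v ` P) S"
    unfolding disjoint_family_on_def
  proof (intro ballI impI)
    fix v w assume vw: "v \<in> S" "w \<in> S" "v \<noteq> w"
    show "(+) v ` P \<inter> (+) w ` P = {}"
    proof (rule ccontr)
      assume "(+) v ` P \<inter> (+) w ` P \<noteq> {}"
      then obtain a b where ab: "a \<in> P" "b \<in> P" "v + a = w + b" by blast
      then have d: "v - w = b - a" by (simp add: algebra_simps)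
      have "transpose h *v (v - w) = 0"
      proof (subst vec_eq_iff, intro allI)
        fix i
        have "(transpose h *v v) $ i \<in> \<int>" "(transpose h *v w) $ i \<in> \<int>"
          using vw S(1) unfolding dual_lattice_of int_vectors_def by blast+
        then have "(transpose h *v (v - w)) $ i \<in> \<int>"
          unfolding matrix_vector_mult_diff_distrib by simp
        moreover have "\<bar>(transpose h *v (v - w)) $ i\<bar> < 1"
          using P_cube[OF ab(1)] P_cube[OF ab(2)]
          unfolding d matrix_vector_mult_diff_distrib mem_box_cart
          by (auto simp del: transpose_matrix_vector) (smt (verit))
        ultimately show "(transpose h *v (v - w)) $ i = (0 :: real^'n) $ i"
          by (simp del: transpose_matrix_vector add: Ints_eq_abs_less1)
      qed
      then have "v - w = transpose_solve h 0" "0 = transpose_solve h 0"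
        using transpose_solve_iff[OF h(1)] by (blast, metis matrix_vector_mult_0_right)
      then show False using vw(3) by simp
    qed
  qed
  then have "measure lebesgue (\<Union>v\<in>S. (+) v ` P) = (\<Sum>v\<in>S. measure lebesgue ((+) v ` P))"
  proof (intro measure_finite_Union)
    show "emeasure lebesgue ((+) v ` P) \<noteq> \<infinity>" for v
      unfolding infinity_ennreal_def using measurable_translation[OF P] by (rule fmeasurableD2)
  qed (use S(2) measurable_translation[OF P] in auto)
  also have "\<dots> = real (card S)" by (simp add: measure_translation mP)
  finally have "real (card S) = measure lebesgue (\<Union>v\<in>S. (+) v ` P)" ..
  also have "\<dots> \<le> measure lebesgue (cbox (\<chi> i. - (2 * T)) (\<chi> i. 2 * T) :: (real^'n) set)"
  proof (rule measure_mono_fmeasurable)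
    show "(\<Union>v\<in>S. (+) v ` P) \<subseteq> cbox (\<chi> i. - (2 * T)) (\<chi> i. 2 * T)"
    proof
      fix x assume "x \<in> (\<Union>v\<in>S. (+) v ` P)"
      then obtain v y where x: "v \<in> S" "y \<in> P" "x = v + y" by blast
      show "x \<in> cbox (\<chi> i. - (2 * T)) (\<chi> i. 2 * T)"
        unfolding mem_box_cart
      proof
        fix i show "(\<chi> i. - (2 * T)) $ i \<le> x $ i \<and> x $ i \<le> (\<chi> i. 2 * T) $ i"
          using S(3)[OF x(1), of i] P_bound[OF x(2), of i] x(3) by (auto simp: abs_le_iff)
      qed
    qed
    show "(\<Union>v\<in>S. (+) v ` P) \<in> sets lebesgue"
      using P S(2) by (intro sets.finite_UN) (auto simp: measurable_translation fmeasurableD)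
  qed simp
  also have "\<dots> = (4 * T) ^ CARD('n)"
  proof -
    have "0 \<le> fact CARD('n) * K ^ CARD('n)" using K by simp
    then have "0 \<le> T" using T by linarith
    then show ?thesis by (simp add: content_cbox_cart interval_ne_empty_cart)
  qed
  finally show ?thesis .
qed

section \<open>Averaging over shears\<close>

text \<open>The sum is the expected number of sets \<open>A f\<close> that contain a random
  point.\<close>

lemma (in prob_space) sum_prob_le_overlap:
  assumes "finite F" "\<And>f. f \<in> F \<Longrightarrow> A f \<in> events"
    and "\<And>\<omega>. \<omega> \<in> space M \<Longrightarrow> real (card {f \<in> F. \<omega> \<in> A f}) \<le> c"
  shows "(\<Sum>f\<in>F. prob (A f)) \<le> c"
proof -
  have int: "integrable M (\<lambda>\<omega>. \<Sum>f\<in>F. indicator (A f) \<omega> :: real)"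
    using assms(2) by (intro Bochner_Integration.integrable_sum) (auto simp: integrable_indicator_iff emeasure_eq_measure)
  have "(\<Sum>f\<in>F. prob (A f)) = (\<integral>\<omega>. (\<Sum>f\<in>F. indicator (A f) \<omega>) \<partial>M)"
    using assms(2)
    by (subst Bochner_Integration.integral_sum) (auto simp: integrable_indicator_iff emeasure_eq_measure)
  also have "\<dots> \<le> (\<integral>\<omega>. c \<partial>M)"
  proof (intro integral_mono int)
    fix \<omega> assume "\<omega> \<in> space M"
    have "(\<Sum>f\<in>F. indicator (A f) \<omega> :: real) = real (card {f \<in> F. \<omega> \<in> A f})"
      using assms(1) by (simp add: indicator_def sum.If_cases Int_def)
    then show "(\<Sum>f\<in>F. indicator (A f) \<omega> :: real) \<le> c" using assms(3) \<open>\<omega> \<in> space M\<close> by simp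
  qed simp
  finally show ?thesis by (simp add: prob_space)
qed

text \<open>A shear along coordinate \<open>k\<close>, scaled by 1 / s, with the entry at (k, k)
  raised to s^(n-1) to keep determinant 1.\<close>

definition shear :: "'n \<Rightarrow> real \<Rightarrow> ('n \<Rightarrow> nat) \<Rightarrow> real^'n^'n" where
  "shear k s f = (\<chi> i j. if j = k then (if i = k then s ^ CARD('n) else 6 * real (f i)) / s
     else if i = j then 1 / s else 0)"

lemma shear_mult:
  "(shear k s f *v w) $ i =
    (if i = k then s ^ CARD('n) * w $ k else 6 * real (f i) * w $ k + w $ i) / s"
  for w :: "real^'n"
proof -
  have "(shear k s f *v w) $ i =
      (\<Sum>j\<in>UNIV. (if j = k then (if i = k then s ^ CARD('n) else 6 * real (f i)) / s * w $ j else 0) +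
        (if j = i then if i = k then 0 else w $ j / s else 0))"
    unfolding matrix_vector_mult_def shear_def by (auto intro!: sum.cong)
  also have "\<dots> = (if i = k then s ^ CARD('n) * w $ k else 6 * real (f i) * w $ k + w $ i) / s"
    by (simp add: sum.distrib add_divide_distrib)
  finally show ?thesis .
qed

lemma shear_SL_real:
  assumes "s > 0"
  shows "(shear k s f :: real^'n^'n) \<in> SL_real"
proof -
  let ?A = "(\<chi> i j. if i = j then 1 / s else 0) :: real^'n^'n"
  let ?x = "(\<chi> i. if i = k then s ^ CARD('n) else 6 * real (f i)) :: real^'n"
  have "(?A *v x) $ i = x $ i / s" for x :: "real^'n" and i
    by (simp add: matrix_vector_mult_def if_distrib[of "\<lambda>a. a * _"] cong: if_cong)
  then have "shear k s f = (\<chi> i j. if j = k then (?A *v ?x) $ i else ?A $ i $ j)"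
    by (auto simp: shear_def vec_eq_iff)
  then have "det (shear k s f :: real^'n^'n) = ?x $ k * det ?A" by (simp only: cramer_lemma)
  moreover have "det ?A = (1 / s) ^ CARD('n)" by (subst det_diagonal) auto
  ultimately show ?thesis using assms by (simp add: SL_real_def power_divide)
qed

text \<open>The fraction 1/3 is small enough for every nonzero number below \<open>e\<close> in
  absolute value to have an integer multiple in range (\<open>multiple_in_third\<close>). Strict
  inequalities make the hitting sets open, hence measurable.\<close>

definition slab :: "'n \<Rightarrow> real \<Rightarrow> (real^'n) set" where
  "slab k e = {w. e / 3 < w $ k \<and> (\<forall>i. \<bar>w $ i\<bar> < e)}"

lemma open_slab: "open (slab k e)"
proof -
  have "slab k e = {w. e / 3 < w $ k} \<inter> (\<Inter>i. {w. \<bar>w $ i\<bar> < e})" by (auto simp: slab_def)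
  then show ?thesis by (auto intro!: open_Int open_INT open_Collect_less continuous_intros)
qed

text \<open>The relation between \<open>s\<close> and \<open>m\<close> balances the images: the
  stretched coordinate \<open>k\<close> and the sheared ones, where 6 (m - 1) + 1 <= 6 m, obey the
  same bound.\<close>

lemma shear_slab_bound:
  fixes v :: "real^'n"
  assumes "s > 0" "s ^ CARD('n) = 6 * real m" "m > 0" "e > 0"
    and "v \<in> (*v) (shear k s f) ` slab k e" "\<And>i. i \<noteq> k \<Longrightarrow> f i < m"
  shows "\<bar>v $ i\<bar> \<le> e * (6 * real m) / s"
proof -
  obtain w where w: "v = shear k s f *v w" "w \<in> slab k e" using assms(5) by blast
  have wi: "\<bar>w $ j\<bar> \<le> e" for j using w(2) by (auto simp: slab_def less_imp_le)
  have "\<bar>if i = k then s ^ CARD('n) * w $ k else 6 * real (f i) * w $ k + w $ i\<bar> \<le> 6 * real m * e"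
  proof (cases "i = k")
    case True
    then show ?thesis using wi[of k] by (simp add: assms(2) abs_mult mult_left_mono)
  next
    case False
    have "f i + 1 \<le> m" using assms(6) False by (simp add: Suc_le_eq)
    then have f: "6 * real (f i) + 1 \<le> 6 * real m" by linarith
    have "\<bar>6 * real (f i) * w $ k + w $ i\<bar> \<le> 6 * real (f i) * \<bar>w $ k\<bar> + \<bar>w $ i\<bar>"
      by (rule order_trans[OF abs_triangle_ineq]) (simp add: abs_mult)
    also have "\<dots> \<le> 6 * real (f i) * e + e" using wi by (intro add_mono mult_left_mono) auto
    also have "\<dots> = (6 * real (f i) + 1) * e" by (simp add: algebra_simps)
    also have "\<dots> \<le> 6 * real m * e" using f assms(4) by (intro mult_right_mono) auto
    finally show ?thesis using False by simp
  qed
  then show ?thesis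
    using assms(1) unfolding w(1) shear_mult by (simp add: divide_right_mono abs_divide mult.commute)
qed

text \<open>Coordinate \<open>k\<close> of the image determines \<open>w $ k > e / 3\<close>, and the spacing \<open>6\<close> between the shear
  parameters then moves the other coordinates apart by more than \<open>2 * e\<close>.\<close>

lemma shear_slab_disjoint:
  fixes f g :: "'n::finite \<Rightarrow> nat"
  assumes "s > 0" "e > 0" "i \<noteq> k" "f i \<noteq> g i"
  shows "(*v) (shear k s f) ` slab k e \<inter> (*v) (shear k s g) ` slab k e = {}"
proof (rule ccontr)
  assume "(*v) (shear k s f) ` slab k e \<inter> (*v) (shear k s g) ` slab k e \<noteq> {}"
  then obtain a b where ab: "a \<in> slab k e" "b \<in> slab k e" "shear k s f *v a = shear k s g *v b"
    by blast
  have eq: "(shear k s f *v a) $ j = (shear k s g *v b) $ j" for j using ab(3) by simp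
  from eq[of k] have k: "a $ k = b $ k" using assms(1) by (simp add: shear_mult)
  from eq[of i] have "6 * real (f i) * a $ k + a $ i = 6 * real (g i) * b $ k + b $ i"
    using assms(1,3) by (simp add: shear_mult)
  then have "6 * (real (f i) - real (g i)) * a $ k = b $ i - a $ i"
    unfolding k by (simp add: algebra_simps)
  then have "6 * \<bar>real (f i) - real (g i)\<bar> * \<bar>a $ k\<bar> = \<bar>b $ i - a $ i\<bar>"
    by (metis abs_mult abs_numeral)
  also have "\<dots> < 2 * e"
  proof -
    have "\<bar>b $ i\<bar> < e" "\<bar>a $ i\<bar> < e" using ab(1,2) by (auto simp: slab_def)
    then show ?thesis by linarith
  qed
  also have "2 * e = 6 * 1 * (e / 3)" by simp
  also have "\<dots> \<le> 6 * \<bar>real (f i) - real (g i)\<bar> * \<bar>a $ k\<bar>"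
  proof (intro mult_mono)
    show "1 \<le> \<bar>real (f i) - real (g i)\<bar>" using assms(4) by linarith
    show "e / 3 \<le> \<bar>a $ k\<bar>" using ab(1) by (auto simp: slab_def)
  qed (use assms(2) in auto)
  finally show False by simp
qed

text \<open>One dual vector is chosen in each image that is hit. Disjointness makes the choice
  injective, so the packing bound applies to its range.\<close>

lemma card_dual_hits_shear_le:
  fixes L :: "(real^'n) set"
  assumes s: "s > 0" "s ^ CARD('n) = 6 * real m" "m > 0" and e: "e > 0"
    and K: "1 \<le> K" "fact CARD('n) * K ^ CARD('n) \<le> e * (6 * real m) / s"
    and L: "L \<in> bounded_lattices K"
  shows "real (card {f \<in> (UNIV - {k}) \<rightarrow>\<^sub>E {..<m}. L \<in> dual_hits ((*v) (shear k s f) ` slab k e)})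
    \<le> (4 * (e * (6 * real m) / s)) ^ CARD('n)"
proof -
  let ?B = "\<lambda>f. (*v) (shear k s f) ` slab k e"
  define G where "G = {f \<in> (UNIV - {k}) \<rightarrow>\<^sub>E {..<m}. L \<in> dual_hits (?B f)}"
  obtain h where h: "h \<in> SL_real" "\<And>i j. \<bar>h $ i $ j\<bar> \<le> K" "L = lattice_of h"
    using L by (auto simp: bounded_lattices_def intro: less_imp_le)
  have "\<forall>f\<in>G. \<exists>v. v \<in> dual_lattice L \<and> v \<in> ?B f" by (auto simp: G_def hits_def)
  then obtain v where v: "\<And>f. f \<in> G \<Longrightarrow> v f \<in> dual_lattice L" "\<And>f. f \<in> G \<Longrightarrow> v f \<in> ?B f"
    by metis
  have "finite ((UNIV - {k}) \<rightarrow>\<^sub>E {..<m})" by (intro finite_PiE) auto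
  then have "finite G" by (simp add: G_def)
  have "inj_on v G"
  proof (rule inj_onI, rule ccontr)
    fix f g assume fg: "f \<in> G" "g \<in> G" "v f = v g" "f \<noteq> g"
    then obtain i where "f i \<noteq> g i" by blast
    \<comment> \<open>Extensional functions all take the value \<open>undefined\<close> at
      \<open>k\<close>, so distinct ones differ elsewhere.\<close>
    moreover have "i \<noteq> k"
      using fg \<open>f i \<noteq> g i\<close> by (auto simp: G_def PiE_def extensional_def)
    ultimately show False
      using shear_slab_disjoint[OF s(1) e] v(2)[OF fg(1)] v(2)[OF fg(2)] fg(3) by (metis disjoint_iff)
  qed
  then have "real (card G) = real (card (v ` G))" by (simp add: card_image)
  also have "\<dots> \<le> (4 * (e * (6 * real m) / s)) ^ CARD('n)"
  proof (rule card_dual_lattice_le[OF h(1,2) K(1) _ _ _ K(2)])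
    show "v ` G \<subseteq> dual_lattice (lattice_of h)" using v(1) h(3) by auto
    show "finite (v ` G)" using \<open>finite G\<close> by simp
    fix u i assume "u \<in> v ` G"
    then obtain f where f: "f \<in> G" "u = v f" by blast
    then have "\<And>i. i \<noteq> k \<Longrightarrow> f i < m" by (auto simp: G_def PiE_def Pi_def)
    with shear_slab_bound[OF s e v(2)[OF f(1)]] show "\<bar>u $ i\<bar> \<le> e * (6 * real m) / s"
      using f(2) by simp
  qed
  finally show ?thesis by (simp add: G_def)
qed

text \<open>Intersecting with W = \<open>bounded_lattices K\<close> lowers each of the m^(n-1) equal
  probabilities by at most 1 - mu(W), and a lattice in W hits at most (4 T)^n images.\<close>

lemma measure_dual_hits_slab_aux:
  fixes \<mu> :: "(real^'n) set measure"
  assumes \<mu>: "invariant_prob_measure \<mu>"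
    and s: "s > 0" "s ^ CARD('n) = 6 * real m" "m > 0" and e: "e > 0"
    and K: "1 \<le> K" "fact CARD('n) * K ^ CARD('n) \<le> e * (6 * real m) / s"
  shows "measure \<mu> (dual_hits (slab k e))
    \<le> 4 ^ CARD('n) * 6 ^ (CARD('n) - 1) * e ^ CARD('n) + (1 - measure \<mu> (bounded_lattices K))"
proof -
  interpret prob_space \<mu> using \<mu> by (simp add: invariant_prob_measure_def)
  define F where "F = (UNIV - {k}) \<rightarrow>\<^sub>E {..<m}"
  define H where "H f = dual_hits ((*v) (shear k s f) ` slab k e)" for f
  define W where "W = (bounded_lattices K :: (real^'n) set set)"
  define T where "T = e * (6 * real m) / s"
  let ?p = "prob (dual_hits (slab k e))"
  have finF: "finite F" unfolding F_def by (intro finite_PiE) auto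
  have cardF: "real (card F) = real m ^ (CARD('n) - 1)"
    unfolding F_def by (subst card_PiE) (auto simp: card_Diff_singleton)
  have W: "W \<in> events"
    using invariant_sets[OF \<mu>] openin_Omega0_sets[OF openin_bounded_lattices] by (simp add: W_def)
  have opn: "open ((*v) (shear k s f) ` slab k e)" for f
  proof -
    have "surj ((*v) (shear k s f :: real^'n^'n))"
      using shear_SL_real[OF s(1)] SL_real_inverse
      by (metis matrix_right_invertible_surjective)
    then show ?thesis
      by (intro open_surjective_linear_image open_slab matrix_vector_mul_linear)
  qed
  have H: "H f \<in> events" for f
    unfolding H_def by (rule dual_hits_events[OF \<mu> opn])
  have pH: "prob (H f) = ?p" for f
    unfolding H_def by (rule measure_dual_hits_image[OF \<mu> shear_SL_real[OF s(1)] open_slab])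
  have "(\<Sum>f\<in>F. prob (H f \<inter> W)) \<le> (4 * T) ^ CARD('n)"
  proof (rule sum_prob_le_overlap[OF finF])
    fix L assume "L \<in> space \<mu>"
    show "real (card {f \<in> F. L \<in> H f \<inter> W}) \<le> (4 * T) ^ CARD('n)"
    proof (cases "L \<in> W")
      case True
      then show ?thesis
        using card_dual_hits_shear_le[OF s e K, of L k] by (simp add: F_def H_def W_def T_def)
    next
      case False
      have "T \<ge> 0" using s(1) e by (simp add: T_def)
      with False show ?thesis by simp
    qed
  qed (use H W in auto)
  moreover have "?p - (1 - prob W) \<le> prob (H f \<inter> W)" for f
  proof -
    have "prob (H f) \<le> prob (H f \<inter> W) + prob (space \<mu> - W)"
    proof -
      have "prob (H f) \<le> prob ((H f \<inter> W) \<union> (space \<mu> - W))"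
        using H W sets.sets_into_space[OF H] by (intro finite_measure_mono) auto
      also have "\<dots> \<le> prob (H f \<inter> W) + prob (space \<mu> - W)"
        using H W by (intro measure_Un_le) auto
      finally show ?thesis .
    qed
    then show ?thesis using prob_compl[OF W] by (simp add: pH)
  qed
  then have "(\<Sum>f\<in>F. ?p - (1 - prob W)) \<le> (\<Sum>f\<in>F. prob (H f \<inter> W))" by (intro sum_mono)
  ultimately have "real m ^ (CARD('n) - 1) * (?p - (1 - prob W)) \<le> (4 * T) ^ CARD('n)"
    by (simp add: cardF)
  \<comment> \<open>\<open>s ^ CARD('n)\<close> cancels one of the n factors 6 m in T^n; what
    remains contains m^(n-1), the number of shears, so \<open>m\<close> drops out.\<close>
  also have "(4 * T) ^ CARD('n) =
      real m ^ (CARD('n) - 1) * (4 ^ CARD('n) * 6 ^ (CARD('n) - 1) * e ^ CARD('n))"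
  proof -
    have "(6 * real m) ^ CARD('n) = (6 * real m) * (6 * real m) ^ (CARD('n) - 1)"
      by (metis power_eq_if zero_less_card_finite less_irrefl)
    then have "T ^ CARD('n) = e ^ CARD('n) * (6 * real m) ^ (CARD('n) - 1)"
      using s by (simp add: T_def power_mult_distrib power_divide)
    then show ?thesis by (simp add: power_mult_distrib)
  qed
  finally have "?p - (1 - prob W) \<le> 4 ^ CARD('n) * 6 ^ (CARD('n) - 1) * e ^ CARD('n)"
    using s(3) by simp
  then show ?thesis by (simp add: W_def)
qed

text \<open>\<open>m\<close> may be chosen after K, so the error term can be sent to 0. The counting
  bound asks for T = e s^(n-1) >= n! K^n, which a large \<open>s\<close> achieves because n >=
  2.\<close>

lemma measure_dual_hits_slab:
  fixes \<mu> :: "(real^'n) set measure"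
  assumes \<mu>: "invariant_prob_measure \<mu>" and n: "CARD('n) \<ge> 2" and e: "e > 0"
  shows "measure \<mu> (dual_hits (slab k e)) \<le> 4 ^ CARD('n) * 6 ^ (CARD('n) - 1) * e ^ CARD('n)"
    (is "?p \<le> ?c")
proof -
  let ?n = "CARD('n)"
  have "?p \<le> ?c + (1 - measure \<mu> (bounded_lattices (real j)))" if "j \<ge> 1" for j :: nat
  proof -
    obtain r :: nat where r: "fact ?n * real j ^ ?n / e < real r"
      using reals_Archimedean2 by blast
    have "0 \<le> fact ?n * real j ^ ?n / e" using e by simp
    then have r0: "r > 0" using r by linarith
    \<comment> \<open>A multiple of 6, so that \<open>s ^ ?n = 6 * real m\<close> holds with a
      natural number \<open>m\<close>.\<close>
    define s where "s = 6 * real r"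
    define m where "m = 6 ^ (?n - 1) * r ^ ?n"
    have pow: "a ^ ?n = a * a ^ (?n - 1)" for a :: real
      by (metis power_eq_if zero_less_card_finite less_irrefl)
    have s: "s > 0" "m > 0" using r0 by (auto simp: s_def m_def)
    have sm: "s ^ ?n = 6 * real m"
      using pow[of 6] by (simp add: s_def m_def power_mult_distrib)
    have "s \<ge> 1" using r0 by (simp add: s_def)
    then have "s ^ 1 \<le> s ^ (?n - 1)" using n by (intro power_increasing) auto
    moreover have "real r \<le> s" by (simp add: s_def)
    ultimately have "fact ?n * real j ^ ?n / e \<le> s ^ (?n - 1)" using r by simp
    then have "fact ?n * real j ^ ?n \<le> e * s ^ (?n - 1)" using e by (simp add: field_simps)
    also have "\<dots> = e * (6 * real m) / s" using s(1) unfolding sm[symmetric] pow[of s] by simp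
    finally show ?thesis
      using that by (intro measure_dual_hits_slab_aux[OF \<mu> s(1) sm s(2) e]) auto
  qed
  moreover have "(\<lambda>j. ?c + (1 - measure \<mu> (bounded_lattices (real j)))) \<longlonglongrightarrow> ?c + (1 - 1)"
    by (intro tendsto_intros tendsto_bounded_lattices[OF \<mu>])
  ultimately show ?thesis
    using LIMSEQ_le_const[of _ "?c + (1 - 1)" ?p] by fastforce
qed

text \<open>If |a| <= e / 3, the first multiple of |a| beyond e / 3 is at most 2 e / 3.\<close>

lemma multiple_in_third:
  fixes a e :: real
  assumes "a \<noteq> 0" "\<bar>a\<bar> < e"
  obtains c :: int where "e / 3 < c * a" "c * a < e"
proof -
  define b where "b = \<bar>a\<bar>"
  have b: "b > 0" "b < e" using assms by (auto simp: b_def)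
  obtain c :: int where c: "e / 3 < c * b" "c * b < e"
  proof (cases "e / 3 < b")
    case True
    then show ?thesis using that[of 1] b by simp
  next
    case False
    let ?c = "\<lfloor>e / (3 * b)\<rfloor> + 1"
    have c: "e / (3 * b) < ?c" "?c \<le> e / (3 * b) + 1" by linarith+
    have eq: "e / (3 * b) * b = e / 3" "(e / (3 * b) + 1) * b = e / 3 + b"
      using b(1) by (simp_all add: distrib_right)
    have "e / 3 < ?c * b"
      using mult_strict_right_mono[OF c(1) b(1)] unfolding eq .
    moreover have "?c * b \<le> e / 3 + b"
      using mult_right_mono[OF c(2), of b] b(1) unfolding eq by simp
    ultimately show ?thesis using that[of ?c] b False by linarith
  qed
  have "of_int (if a > 0 then c else - c) * a = c * b" using assms(1) by (auto simp: b_def)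
  with c that show ?thesis by metis
qed

text \<open>Take \<open>k\<close> to be a coordinate of largest absolute value: once an integer
  multiple brings it between e / 3 and e, the others stay below e.\<close>

lemma short_dual_vector_multiple:
  fixes w :: "real^'n"
  assumes "w \<in> dual_lattice L" "w \<noteq> 0" "norm w < e"
  obtains k where "dual_lattice L \<inter> slab k e \<noteq> {}"
proof -
  have "Max (range (\<lambda>i. \<bar>w $ i\<bar>)) \<in> range (\<lambda>i. \<bar>w $ i\<bar>)" by (intro Max_in) auto
  then obtain k where "Max (range (\<lambda>i. \<bar>w $ i\<bar>)) = \<bar>w $ k\<bar>" by blast
  then have k: "\<bar>w $ i\<bar> \<le> \<bar>w $ k\<bar>" for i
    by (metis Max_ge finite finite_imageI rangeI)
  have "w $ k \<noteq> 0"
  proof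
    assume "w $ k = 0"
    then have "w $ i = 0" for i using k[of i] by simp
    then show False using assms(2) by (simp add: vec_eq_iff)
  qed
  moreover have "\<bar>w $ k\<bar> < e"
    using component_le_norm_cart assms(3) by (rule le_less_trans)
  ultimately obtain c :: int where c: "e / 3 < c * w $ k" "c * w $ k < e"
    by (rule multiple_in_third)
  have "0 < e" using assms(3) norm_ge_zero by (rule le_less_trans[rotated])
  have "\<bar>c * w $ i\<bar> < e" for i
  proof -
    have "\<bar>c * w $ i\<bar> \<le> \<bar>c * w $ k\<bar>" using k by (simp add: abs_mult mult_left_mono)
    then show ?thesis using c \<open>0 < e\<close> by linarith
  qed
  then have "of_int c *\<^sub>R w \<in> slab k e" using c(1) by (simp add: slab_def)
  moreover have "of_int c *\<^sub>R w \<in> dual_lattice L"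
    using assms(1) by (simp add: dual_lattice_def)
  ultimately show ?thesis using that by blast
qed

theorem theorem1p2:
  fixes d :: nat
  assumes "d \<ge> 3" and "CARD('n::finite) = d - 1"
  shows "\<exists>C>0. \<forall>\<mu> :: (real^'n) set measure. invariant_prob_measure \<mu> \<longrightarrow>
           (\<forall>R>0. Psi \<mu> R < C * R powi (- int (d - 1)))"
proof -
  let ?n = "CARD('n)"
  have n: "?n \<ge> 2" using assms by simp
  \<comment> \<open>The length threshold in \<open>covering_radius_le\<close> is a / R.\<close>
  define a where "a = 2 * 3 ^ ?n * real ?n"
  define C where "C = real ?n * (4 ^ ?n * 6 ^ (?n - 1) * a ^ ?n)"
  \<comment> \<open>\<open>C\<close> is fixed before the measure; the added 1 makes the final
    estimate strict.\<close>
  have C: "C + 1 > 0" by (simp add: C_def a_def add_nonneg_pos)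
  have "Psi \<mu> R < (C + 1) * R powi (- int (d - 1))"
    if \<mu>: "invariant_prob_measure \<mu>" and R: "R > 0" for \<mu> :: "(real^'n) set measure" and R
  proof -
    interpret prob_space \<mu> using \<mu> by (simp add: invariant_prob_measure_def)
    define e where "e = a / R"
    have e: "e > 0" using R by (simp add: e_def a_def)
    have E: "covering_sublevel R \<in> events"
      using covering_sublevel_sets[OF R] invariant_sets[OF \<mu>] by simp
    have "space \<mu> - covering_sublevel R \<subseteq> (\<Union>k. dual_hits (slab k e))"
    proof
      fix L assume "L \<in> space \<mu> - covering_sublevel R"
      then have L: "L \<in> Omega0" "\<not> covering_radius L \<le> R"
        by (auto simp: covering_sublevel_def invariant_space[OF \<mu>])
      then obtain w where "w \<in> dual_lattice L" "w \<noteq> 0" "norm w < e"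
        using covering_radius_le[OF L(1) R] unfolding e_def a_def by force
      then obtain k where "dual_lattice L \<inter> slab k e \<noteq> {}"
        by (rule short_dual_vector_multiple)
      then show "L \<in> (\<Union>k. dual_hits (slab k e))"
        using L(1) by (auto simp: hits_def)
    qed
    then have "prob (space \<mu> - covering_sublevel R) \<le> prob (\<Union>k. dual_hits (slab k e))"
      using dual_hits_events[OF \<mu> open_slab] by (intro finite_measure_mono) auto
    also have "\<dots> \<le> (\<Sum>k\<in>UNIV. prob (dual_hits (slab k e)))"
      using dual_hits_events[OF \<mu> open_slab] by (intro finite_measure_subadditive_finite) auto
    also have "\<dots> \<le> real ?n * (4 ^ ?n * 6 ^ (?n - 1) * e ^ ?n)"
      using measure_dual_hits_slab[OF \<mu> n e] by (intro sum_bounded_above)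
    also have "\<dots> = C / R ^ ?n" by (simp add: C_def e_def power_divide)
    also have "\<dots> < (C + 1) / R ^ ?n" using R by (intro divide_strict_right_mono) auto
    finally show ?thesis
      using prob_compl[OF E] assms(2) by (simp add: Psi_def power_int_minus divide_inverse)
  qed
  with C show ?thesis by blast
qed

end
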